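(* Let $M=(M^{2n+s},f,\xi_i,\eta_i,g)$ be a trans-$S$-manifold with associated smooth functions $\alpha_i,\beta_i$ ($i=1,\dots,s$), and let $\gamma:I\to M$ be a Legendre Frenet curve of osculating order $r=2$. Then $\gamma$ is $C$-proper in the tangent bundle, with non-zero function $\lambda$, if and only if it is a circle with $$\kappa_1=\mp\sqrt{s}\,\beta=\text{constant}$$ and Frenet frame field $$\left\{T,\ \frac{\pm1}{\sqrt{s}}\sum_{i=1}^s\xi_i\right\}$$ (upper signs together or lower signs together). In this case, along $\gamma$, $\beta_1=\beta_2=\dots=\beta_s=\beta$ (which is the meaning of $\beta$), $\lambda=-s\beta^3=\text{constant}$, and $\sum_{i=1}^s\alpha_i=0$.
   Context: A framed metric $f$-manifold $(M^{2n+s},f,\xi_i,\eta_i,g)$ is a $(2n+s)$-dimensional Riemannian manifold $(M,g)$ with a $(1,1)$-tensor field $f$ of rank $2n$, vector fields $\xi_1,\dots,\xi_s$ and 1-forms $\eta_1,\dots,\eta_s$ such that $f^2=-I+\sum_i\eta_i\otimes\xi_i$, $\eta_i(\xi_j)=\delta_{ij}$, $f\xi_i=0$, $\eta_i\circ f=0$, $g(fX,fY)=g(X,Y)-\sum_i\eta_i(X)\eta_i(Y)$, and $\eta_i(X)=g(X,\xi_i)$. It is normal if $[f,f]+2\sum_i d\eta_i\otimes\xi_i=0$, where $[f,f]$ is the Nijenhuis tensor of $f$ and $2d\eta(X,Y)=X\eta(Y)-Y\eta(X)-\eta([X,Y])$. A trans-$S$-manifold is a normal framed metric $f$-manifold for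 which there are smooth functions $\alpha_i,\beta_i$ ($i=1,\dots,s$) with $$(\nabla_Xf)Y=\sum_{i=1}^s\Big[\alpha_i\{g(fX,fY)\xi_i+\eta_i(Y)f^2X\}+\beta_i\{g(fX,Y)\xi_i-\eta_i(Y)fX\}\Big]$$ for all vector fields $X,Y$, where $\nabla$ is the Levi-Civita connection of $g$. A Frenet curve of osculating order $r$ is a unit-speed curve $\gamma$ with orthonormal fields $E_1=T=\gamma',E_2,\dots,E_r$ along $\gamma$ and positive functions $\kappa_1,\dots,\kappa_{r-1}$ on $I$ with $\nabla_TE_1=\kappa_1E_2$, $\nabla_TE_j=-\kappa_{j-1}E_{j-1}+\kappa_jE_{j+1}$ ($2\le j\le r-1$), $\nabla_TE_r=-\kappa_{r-1}E_{r-1}$. A circle is a Frenet curve of osculating order 2 with $\kappa_1$ a non-zero positive constant. A curve is Legendre if $\eta_i(T)=0$ for all $i$. The mean curvature vector field is $H=\nabla_TT$, and the Laplacian along $\gamma$ is $\Delta H=-\nabla_T\nabla_TH$. $\gamma$ is $C$-proper in the tangent bundle (with function $\lambda$) if $\Delta H=\lambda\sum_{i=1}^s\xi_i$ along $\gamma$, where $\lambda$ is a non-zero (nowhere vanishing) differentiable real-valued function on $I$. Functions $\alpha_i,\beta_i$ in equations along $\gamma$ mean their restrictions to $\gamma$. *)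

theory Defs
  imports "HOL-Analysis.Analysis" "HOL-Library.Function_Algebras"
begin

section \<open>Pointwise vector space structure on functions\<close>

instantiation "fun" :: (type, scaleR) scaleR
begin

definition scaleR_fun :: "real \<Rightarrow> ('a \<Rightarrow> 'b) \<Rightarrow> 'a \<Rightarrow> 'b"
  where "scaleR_fun r v = (\<lambda>x. r *\<^sub>R v x)"

instance ..

end

instance "fun" :: (type, real_vector) real_vector
  by standard (auto simp: scaleR_fun_def plus_fun_def fun_eq_iff algebra_simps)

lemma scaleR_fun_apply [simp]: "(r *\<^sub>R v) x = r *\<^sub>R v x"
  by (simp add: scaleR_fun_def)


section \<open>Smooth maps between open subsets of Euclidean spaces\<close>

text \<open>Meant for open \<open>S\<close>.  The domain is finite-dimensional in every use, so \<open>C\<close>-\<open>Suc k\<close>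
  can be phrased through the directional derivatives.\<close>

primrec Ck_on ::
  "nat \<Rightarrow> 'a::real_normed_vector set \<Rightarrow> ('a \<Rightarrow> 'b::real_normed_vector) \<Rightarrow> bool" where
  "Ck_on 0 S h \<longleftrightarrow> continuous_on S h"
| "Ck_on (Suc k) S h \<longleftrightarrow>
     (\<forall>x\<in>S. h differentiable (at x)) \<and>
     (\<forall>v. Ck_on k S (\<lambda>x. frechet_derivative h (at x) v))"

definition smooth_on ::
  "'a::real_normed_vector set \<Rightarrow> ('a \<Rightarrow> 'b::real_normed_vector) \<Rightarrow> bool" where
  "smooth_on S h \<longleftrightarrow> (\<forall>k. Ck_on k S h)"


section \<open>Smooth manifolds, tangent vectors and tensor fields\<close>

text \<open>Only the values of \<open>chart_map\<close> on \<open>chart_dom\<close> matter.\<close>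

datatype ('a, 'e) chart = Chart (chart_dom: "'a set") (chart_map: "'a \<Rightarrow> 'e")

definition chart_inv :: "('a, 'e) chart \<Rightarrow> 'e \<Rightarrow> 'a" where
  "chart_inv c = inv_into (chart_dom c) (chart_map c)"

definition chart_image :: "('a, 'e) chart \<Rightarrow> 'e set" where
  "chart_image c = chart_map c ` chart_dom c"

definition is_chart :: "('a::topological_space, 'e::euclidean_space) chart \<Rightarrow> bool" where
  "is_chart c \<longleftrightarrow> open (chart_dom c) \<and> open (chart_image c) \<and>
     homeomorphism (chart_dom c) (chart_image c) (chart_map c) (chart_inv c)"

definition transition :: "('a, 'e) chart \<Rightarrow> ('a, 'e) chart \<Rightarrow> 'e \<Rightarrow> 'e" where
  "transition c d = chart_map d \<circ> chart_inv c"

definition charts_at :: "('a, 'e) chart set \<Rightarrow> 'a \<Rightarrow> ('a, 'e) chart set" where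
  "charts_at A p = {c \<in> A. p \<in> chart_dom c}"

text \<open>The underlying space of the manifold is the whole type \<open>'a\<close>; the atlas \<open>A\<close> need not be
  maximal.\<close>

locale smooth_manifold =
  fixes A :: "('a::{t2_space, second_countable_topology}, 'e::euclidean_space) chart set"
  assumes charts: "c \<in> A \<Longrightarrow> is_chart c"
    and cover: "(\<Union>c\<in>A. chart_dom c) = UNIV"
    and compatible: "c \<in> A \<Longrightarrow> d \<in> A \<Longrightarrow>
      smooth_on (chart_map c ` (chart_dom c \<inter> chart_dom d)) (transition c d)"

text \<open>A tangent vector at \<open>p\<close> is the family of its coordinate representations in all charts of
  the atlas around \<open>p\<close>, related by the differentials of the transition maps; the entries at all
  other charts are \<open>0\<close>.  The vector space operations are thus the pointwise ones.\<close>

type_synonym ('a, 'e) tangent = "('a, 'e) chart \<Rightarrow> 'e"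

definition tangent_space ::
  "('a, 'e::euclidean_space) chart set \<Rightarrow> 'a \<Rightarrow> ('a, 'e) tangent set" where
  "tangent_space A p = {v.
     (\<forall>c. c \<notin> charts_at A p \<longrightarrow> v c = 0) \<and>
     (\<forall>c\<in>charts_at A p. \<forall>d\<in>charts_at A p.
        v d = frechet_derivative (transition c d) (at (chart_map c p)) (v c))}"

text \<open>The tangent vector at \<open>p\<close> with representation \<open>u\<close> in the chart \<open>c\<close>.\<close>

definition coord_tangent ::
  "('a, 'e::euclidean_space) chart set \<Rightarrow> ('a, 'e) chart \<Rightarrow> 'a \<Rightarrow> 'e \<Rightarrow> ('a, 'e) tangent" where
  "coord_tangent A c p u = (\<lambda>d. if d \<in> charts_at A p
     then frechet_derivative (transition c d) (at (chart_map c p)) u else 0)"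

definition linear_on_subspace ::
  "'v::real_vector set \<Rightarrow> ('v \<Rightarrow> 'w::real_vector) \<Rightarrow> bool" where
  "linear_on_subspace V h \<longleftrightarrow>
     (\<forall>v\<in>V. \<forall>w\<in>V. \<forall>a b. h (a *\<^sub>R v + b *\<^sub>R w) = a *\<^sub>R h v + b *\<^sub>R h w)"

definition smooth_function ::
  "('a, 'e::euclidean_space) chart set \<Rightarrow> ('a \<Rightarrow> real) \<Rightarrow> bool" where
  "smooth_function A h \<longleftrightarrow> (\<forall>c\<in>A. smooth_on (chart_image c) (h \<circ> chart_inv c))"

definition vector_field ::
  "('a, 'e::euclidean_space) chart set \<Rightarrow> ('a \<Rightarrow> ('a, 'e) tangent) \<Rightarrow> bool" where
  "vector_field A X \<longleftrightarrow> (\<forall>p. X p \<in> tangent_space A p) \<and>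
     (\<forall>c\<in>A. smooth_on (chart_image c) (\<lambda>x. X (chart_inv c x) c))"

definition one_form ::
  "('a, 'e::euclidean_space) chart set \<Rightarrow> ('a \<Rightarrow> ('a, 'e) tangent \<Rightarrow> real) \<Rightarrow> bool" where
  "one_form A \<eta> \<longleftrightarrow> (\<forall>p. linear_on_subspace (tangent_space A p) (\<eta> p)) \<and>
     (\<forall>c\<in>A. \<forall>u. smooth_on (chart_image c)
        (\<lambda>x. \<eta> (chart_inv c x) (coord_tangent A c (chart_inv c x) u)))"

definition endo_field ::
  "('a, 'e::euclidean_space) chart set \<Rightarrow>
   ('a \<Rightarrow> ('a, 'e) tangent \<Rightarrow> ('a, 'e) tangent) \<Rightarrow> bool" where
  "endo_field A f \<longleftrightarrow>
     (\<forall>p. f p ` tangent_space A p \<subseteq> tangent_space A p \<and>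
          linear_on_subspace (tangent_space A p) (f p)) \<and>
     (\<forall>c\<in>A. \<forall>u. smooth_on (chart_image c)
        (\<lambda>x. f (chart_inv c x) (coord_tangent A c (chart_inv c x) u) c))"

text \<open>Coordinate expression of a covariant 2-tensor field: \<open>g(u, w)\<close> at the point with
  coordinates \<open>x\<close>, for \<open>u\<close>, \<open>w\<close> given in the chart \<open>c\<close>.\<close>

definition coord_metric ::
  "('a, 'e::euclidean_space) chart set \<Rightarrow>
   ('a \<Rightarrow> ('a, 'e) tangent \<Rightarrow> ('a, 'e) tangent \<Rightarrow> real) \<Rightarrow>
   ('a, 'e) chart \<Rightarrow> 'e \<Rightarrow> 'e \<Rightarrow> 'e \<Rightarrow> real" where
  "coord_metric A g c x u w = (let p = chart_inv c x in
     g p (coord_tangent A c p u) (coord_tangent A c p w))"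

locale riemannian_manifold = smooth_manifold A
  for A :: "('a::{t2_space, second_countable_topology}, 'e::euclidean_space) chart set" +
  fixes g :: "'a \<Rightarrow> ('a, 'e) tangent \<Rightarrow> ('a, 'e) tangent \<Rightarrow> real"
  assumes metric_linear: "v \<in> tangent_space A p \<Longrightarrow> linear_on_subspace (tangent_space A p) (g p v)"
    and metric_sym: "v \<in> tangent_space A p \<Longrightarrow> w \<in> tangent_space A p \<Longrightarrow> g p v w = g p w v"
    and metric_pos: "v \<in> tangent_space A p \<Longrightarrow> v \<noteq> 0 \<Longrightarrow> g p v v > 0"
    and metric_smooth: "c \<in> A \<Longrightarrow> smooth_on (chart_image c) (\<lambda>x. coord_metric A g c x y z)"


section \<open>Differentiation\<close>

text \<open>The derivative of a function in direction of the tangent vector \<open>v\<close> at \<open>p\<close> does not depend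
  on the chart used to compute it.\<close>

definition dir_deriv ::
  "('a, 'e::euclidean_space) chart set \<Rightarrow> 'a \<Rightarrow> ('a, 'e) tangent \<Rightarrow> ('a \<Rightarrow> real) \<Rightarrow> real" where
  "dir_deriv A p v h = (let c = SOME c. c \<in> charts_at A p in
     frechet_derivative (h \<circ> chart_inv c) (at (chart_map c p)) (v c))"

text \<open>Derivative of the coordinate representation of the vector field \<open>Y\<close> in direction \<open>u\<close>.\<close>

definition coord_deriv ::
  "('a, 'e::euclidean_space) chart \<Rightarrow> ('a \<Rightarrow> ('a, 'e) tangent) \<Rightarrow> 'a \<Rightarrow> 'e \<Rightarrow> 'e" where
  "coord_deriv c Y p u =
     frechet_derivative (\<lambda>x. Y (chart_inv c x) c) (at (chart_map c p)) u"

definition lie_bracket ::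
  "('a, 'e::euclidean_space) chart set \<Rightarrow> ('a \<Rightarrow> ('a, 'e) tangent) \<Rightarrow>
   ('a \<Rightarrow> ('a, 'e) tangent) \<Rightarrow> 'a \<Rightarrow> ('a, 'e) tangent" where
  "lie_bracket A X Y p = (\<lambda>c. if c \<in> charts_at A p
     then coord_deriv c Y p (X p c) - coord_deriv c X p (Y p c) else 0)"

text \<open>Normalised by \<open>2d\<eta>(X,Y) = X\<eta>(Y) - Y\<eta>(X) - \<eta>([X,Y])\<close>.\<close>

definition ext_deriv ::
  "('a, 'e::euclidean_space) chart set \<Rightarrow> ('a \<Rightarrow> ('a, 'e) tangent \<Rightarrow> real) \<Rightarrow>
   ('a \<Rightarrow> ('a, 'e) tangent) \<Rightarrow> ('a \<Rightarrow> ('a, 'e) tangent) \<Rightarrow> 'a \<Rightarrow> real" where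
  "ext_deriv A \<eta> X Y p =
     (dir_deriv A p (X p) (\<lambda>q. \<eta> q (Y q)) - dir_deriv A p (Y p) (\<lambda>q. \<eta> q (X q))
       - \<eta> p (lie_bracket A X Y p)) / 2"

definition nijenhuis ::
  "('a, 'e::euclidean_space) chart set \<Rightarrow>
   ('a \<Rightarrow> ('a, 'e) tangent \<Rightarrow> ('a, 'e) tangent) \<Rightarrow>
   ('a \<Rightarrow> ('a, 'e) tangent) \<Rightarrow> ('a \<Rightarrow> ('a, 'e) tangent) \<Rightarrow> 'a \<Rightarrow> ('a, 'e) tangent" where
  "nijenhuis A f X Y p =
     f p (f p (lie_bracket A X Y p))
     + lie_bracket A (\<lambda>q. f q (X q)) (\<lambda>q. f q (Y q)) p
     - f p (lie_bracket A (\<lambda>q. f q (X q)) Y p)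
     - f p (lie_bracket A X (\<lambda>q. f q (Y q)) p)"

text \<open>Christoffel map of the Levi-Civita connection in the chart \<open>c\<close>, i.e. in index notation
  \<open>g\<^sub>k\<^sub>l \<Gamma>\<^sup>l\<^sub>i\<^sub>j = (\<partial>\<^sub>i g\<^sub>j\<^sub>k + \<partial>\<^sub>j g\<^sub>i\<^sub>k - \<partial>\<^sub>k g\<^sub>i\<^sub>j) / 2\<close>.  The vector exists and is unique because \<open>g\<close> is
  nondegenerate.\<close>

definition christoffel ::
  "('a, 'e::euclidean_space) chart set \<Rightarrow>
   ('a \<Rightarrow> ('a, 'e) tangent \<Rightarrow> ('a, 'e) tangent \<Rightarrow> real) \<Rightarrow>
   ('a, 'e) chart \<Rightarrow> 'e \<Rightarrow> 'e \<Rightarrow> 'e \<Rightarrow> 'e" where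
  "christoffel A g c x u w = (THE y. \<forall>z.
     coord_metric A g c x y z =
      (frechet_derivative (\<lambda>x'. coord_metric A g c x' w z) (at x) u
       + frechet_derivative (\<lambda>x'. coord_metric A g c x' u z) (at x) w
       - frechet_derivative (\<lambda>x'. coord_metric A g c x' u w) (at x) z) / 2)"

definition levi_civita ::
  "('a, 'e::euclidean_space) chart set \<Rightarrow>
   ('a \<Rightarrow> ('a, 'e) tangent \<Rightarrow> ('a, 'e) tangent \<Rightarrow> real) \<Rightarrow>
   ('a \<Rightarrow> ('a, 'e) tangent) \<Rightarrow> ('a \<Rightarrow> ('a, 'e) tangent) \<Rightarrow> 'a \<Rightarrow> ('a, 'e) tangent" where
  "levi_civita A g X Y p = (\<lambda>c. if c \<in> charts_at A p
     then coord_deriv c Y p (X p c) + christoffel A g c (chart_map c p) (X p c) (Y p c)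
     else 0)"

definition cov_deriv_endo ::
  "('a, 'e::euclidean_space) chart set \<Rightarrow>
   ('a \<Rightarrow> ('a, 'e) tangent \<Rightarrow> ('a, 'e) tangent \<Rightarrow> real) \<Rightarrow>
   ('a \<Rightarrow> ('a, 'e) tangent \<Rightarrow> ('a, 'e) tangent) \<Rightarrow>
   ('a \<Rightarrow> ('a, 'e) tangent) \<Rightarrow> ('a \<Rightarrow> ('a, 'e) tangent) \<Rightarrow> 'a \<Rightarrow> ('a, 'e) tangent" where
  "cov_deriv_endo A g f X Y p =
     levi_civita A g X (\<lambda>q. f q (Y q)) p - f p (levi_civita A g X Y p)"


section \<open>Framed metric f-manifolds and trans-S-manifolds\<close>

locale framed_metric_f_manifold = riemannian_manifold A g
  for A :: "('a::{t2_space, second_countable_topology}, 'e::euclidean_space) chart set"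
    and g :: "'a \<Rightarrow> ('a, 'e) tangent \<Rightarrow> ('a, 'e) tangent \<Rightarrow> real" +
  fixes n s :: nat
    and f :: "'a \<Rightarrow> ('a, 'e) tangent \<Rightarrow> ('a, 'e) tangent"
    and \<xi> :: "nat \<Rightarrow> 'a \<Rightarrow> ('a, 'e) tangent"
    and \<eta> :: "nat \<Rightarrow> 'a \<Rightarrow> ('a, 'e) tangent \<Rightarrow> real"
  assumes dimension: "DIM('e) = 2 * n + s"
    and s_pos: "s \<ge> 1"
    and f_field: "endo_field A f"
    and f_rank: "dim (f p ` tangent_space A p) = 2 * n"
    and \<xi>_field: "i \<in> {1..s} \<Longrightarrow> vector_field A (\<xi> i)"
    and \<eta>_form: "i \<in> {1..s} \<Longrightarrow> one_form A (\<eta> i)"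
    and f_squared: "v \<in> tangent_space A p \<Longrightarrow>
      f p (f p v) = - v + (\<Sum>i\<in>{1..s}. \<eta> i p v *\<^sub>R \<xi> i p)"
    and \<eta>_\<xi>: "i \<in> {1..s} \<Longrightarrow> j \<in> {1..s} \<Longrightarrow> \<eta> i p (\<xi> j p) = (if i = j then 1 else 0)"
    and f_\<xi>: "i \<in> {1..s} \<Longrightarrow> f p (\<xi> i p) = 0"
    and \<eta>_f: "i \<in> {1..s} \<Longrightarrow> v \<in> tangent_space A p \<Longrightarrow> \<eta> i p (f p v) = 0"
    and metric_f: "v \<in> tangent_space A p \<Longrightarrow> w \<in> tangent_space A p \<Longrightarrow>
      g p (f p v) (f p w) = g p v w - (\<Sum>i\<in>{1..s}. \<eta> i p v * \<eta> i p w)"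
    and \<eta>_metric: "i \<in> {1..s} \<Longrightarrow> v \<in> tangent_space A p \<Longrightarrow> \<eta> i p v = g p v (\<xi> i p)"

locale normal_framed_metric_f_manifold = framed_metric_f_manifold A g n s f \<xi> \<eta>
  for A :: "('a::{t2_space, second_countable_topology}, 'e::euclidean_space) chart set"
    and g n s f \<xi> \<eta> +
  assumes normal: "vector_field A X \<Longrightarrow> vector_field A Y \<Longrightarrow>
    nijenhuis A f X Y p + (\<Sum>i\<in>{1..s}. (2 * ext_deriv A (\<eta> i) X Y p) *\<^sub>R \<xi> i p) = 0"

locale trans_S_manifold = normal_framed_metric_f_manifold A g n s f \<xi> \<eta>
  for A :: "('a::{t2_space, second_countable_topology}, 'e::euclidean_space) chart set"
    and g n s f \<xi> \<eta> +
  fixes \<alpha> \<beta> :: "nat \<Rightarrow> 'a \<Rightarrow> real"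
  assumes \<alpha>_smooth: "i \<in> {1..s} \<Longrightarrow> smooth_function A (\<alpha> i)"
    and \<beta>_smooth: "i \<in> {1..s} \<Longrightarrow> smooth_function A (\<beta> i)"
    and trans_S: "vector_field A X \<Longrightarrow> vector_field A Y \<Longrightarrow>
      cov_deriv_endo A g f X Y p =
        (\<Sum>i\<in>{1..s}.
           \<alpha> i p *\<^sub>R (g p (f p (X p)) (f p (Y p)) *\<^sub>R \<xi> i p + \<eta> i p (Y p) *\<^sub>R f p (f p (X p)))
         + \<beta> i p *\<^sub>R (g p (f p (X p)) (Y p) *\<^sub>R \<xi> i p - \<eta> i p (Y p) *\<^sub>R f p (X p)))"


section \<open>Curves\<close>

text \<open>Curves are parametrised by an open interval \<open>I\<close>.\<close>

definition smooth_curve ::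
  "('a::topological_space, 'e::euclidean_space) chart set \<Rightarrow> real set \<Rightarrow> (real \<Rightarrow> 'a) \<Rightarrow> bool" where
  "smooth_curve A I \<gamma> \<longleftrightarrow> continuous_on I \<gamma> \<and>
     (\<forall>c\<in>A. smooth_on {t \<in> I. \<gamma> t \<in> chart_dom c} (chart_map c \<circ> \<gamma>))"

definition velocity ::
  "('a, 'e::euclidean_space) chart set \<Rightarrow> (real \<Rightarrow> 'a) \<Rightarrow> real \<Rightarrow> ('a, 'e) tangent" where
  "velocity A \<gamma> t = (\<lambda>c. if c \<in> charts_at A (\<gamma> t)
     then vector_derivative (chart_map c \<circ> \<gamma>) (at t) else 0)"

definition vector_field_along ::
  "('a, 'e::euclidean_space) chart set \<Rightarrow> real set \<Rightarrow> (real \<Rightarrow> 'a) \<Rightarrow>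
   (real \<Rightarrow> ('a, 'e) tangent) \<Rightarrow> bool" where
  "vector_field_along A I \<gamma> V \<longleftrightarrow> (\<forall>t\<in>I. V t \<in> tangent_space A (\<gamma> t)) \<and>
     (\<forall>c\<in>A. smooth_on {t \<in> I. \<gamma> t \<in> chart_dom c} (\<lambda>t. V t c))"

text \<open>The covariant derivative along \<open>\<gamma>\<close> induced by the Levi-Civita connection.\<close>

definition cov_deriv_along ::
  "('a, 'e::euclidean_space) chart set \<Rightarrow>
   ('a \<Rightarrow> ('a, 'e) tangent \<Rightarrow> ('a, 'e) tangent \<Rightarrow> real) \<Rightarrow> (real \<Rightarrow> 'a) \<Rightarrow>
   (real \<Rightarrow> ('a, 'e) tangent) \<Rightarrow> real \<Rightarrow> ('a, 'e) tangent" where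
  "cov_deriv_along A g \<gamma> V t = (\<lambda>c. if c \<in> charts_at A (\<gamma> t)
     then vector_derivative (\<lambda>t. V t c) (at t)
        + christoffel A g c (chart_map c (\<gamma> t)) (velocity A \<gamma> t c) (V t c)
     else 0)"

text \<open>The three cases of the Frenet equations are merged: the term with \<open>\<kappa> (j - 1)\<close> is absent for
  \<open>j = 1\<close>, and the term with \<open>\<kappa> j\<close> is absent for \<open>j = r\<close>.  Unit speed is the case \<open>i = j = 1\<close> of
  orthonormality.\<close>

definition frenet_curve ::
  "('a::topological_space, 'e::euclidean_space) chart set \<Rightarrow>
   ('a \<Rightarrow> ('a, 'e) tangent \<Rightarrow> ('a, 'e) tangent \<Rightarrow> real) \<Rightarrow> real set \<Rightarrow> (real \<Rightarrow> 'a) \<Rightarrow>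
   nat \<Rightarrow> (nat \<Rightarrow> real \<Rightarrow> ('a, 'e) tangent) \<Rightarrow> (nat \<Rightarrow> real \<Rightarrow> real) \<Rightarrow> bool" where
  "frenet_curve A g I \<gamma> r E \<kappa> \<longleftrightarrow>
     smooth_curve A I \<gamma> \<and> r \<ge> 1 \<and>
     (\<forall>j\<in>{1..r}. vector_field_along A I \<gamma> (E j)) \<and>
     (\<forall>t\<in>I. E 1 t = velocity A \<gamma> t) \<and>
     (\<forall>t\<in>I. \<forall>i\<in>{1..r}. \<forall>j\<in>{1..r}. g (\<gamma> t) (E i t) (E j t) = (if i = j then 1 else 0)) \<and>
     (\<forall>j\<in>{1..<r}. \<forall>t\<in>I. \<kappa> j t > 0) \<and>
     (\<forall>j\<in>{1..r}. \<forall>t\<in>I. cov_deriv_along A g \<gamma> (E j) t =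
        (if 1 < j then - \<kappa> (j - 1) t *\<^sub>R E (j - 1) t else 0)
        + (if j < r then \<kappa> j t *\<^sub>R E (j + 1) t else 0))"

definition circle_curve ::
  "('a::topological_space, 'e::euclidean_space) chart set \<Rightarrow>
   ('a \<Rightarrow> ('a, 'e) tangent \<Rightarrow> ('a, 'e) tangent \<Rightarrow> real) \<Rightarrow> real set \<Rightarrow> (real \<Rightarrow> 'a) \<Rightarrow>
   (nat \<Rightarrow> real \<Rightarrow> ('a, 'e) tangent) \<Rightarrow> (nat \<Rightarrow> real \<Rightarrow> real) \<Rightarrow> bool" where
  "circle_curve A g I \<gamma> E \<kappa> \<longleftrightarrow>
     frenet_curve A g I \<gamma> 2 E \<kappa> \<and> (\<exists>k>0. \<forall>t\<in>I. \<kappa> 1 t = k)"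

definition legendre_curve ::
  "('a, 'e::euclidean_space) chart set \<Rightarrow> nat \<Rightarrow> (nat \<Rightarrow> 'a \<Rightarrow> ('a, 'e) tangent \<Rightarrow> real) \<Rightarrow>
   real set \<Rightarrow> (real \<Rightarrow> 'a) \<Rightarrow> bool" where
  "legendre_curve A s \<eta> I \<gamma> \<longleftrightarrow> (\<forall>i\<in>{1..s}. \<forall>t\<in>I. \<eta> i (\<gamma> t) (velocity A \<gamma> t) = 0)"

definition mean_curvature ::
  "('a, 'e::euclidean_space) chart set \<Rightarrow>
   ('a \<Rightarrow> ('a, 'e) tangent \<Rightarrow> ('a, 'e) tangent \<Rightarrow> real) \<Rightarrow> (real \<Rightarrow> 'a) \<Rightarrow>
   real \<Rightarrow> ('a, 'e) tangent" where
  "mean_curvature A g \<gamma> = cov_deriv_along A g \<gamma> (velocity A \<gamma>)"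

definition laplacian_along ::
  "('a, 'e::euclidean_space) chart set \<Rightarrow>
   ('a \<Rightarrow> ('a, 'e) tangent \<Rightarrow> ('a, 'e) tangent \<Rightarrow> real) \<Rightarrow> (real \<Rightarrow> 'a) \<Rightarrow>
   (real \<Rightarrow> ('a, 'e) tangent) \<Rightarrow> real \<Rightarrow> ('a, 'e) tangent" where
  "laplacian_along A g \<gamma> V t = - cov_deriv_along A g \<gamma> (cov_deriv_along A g \<gamma> V) t"

definition C_proper_tangent ::
  "('a, 'e::euclidean_space) chart set \<Rightarrow>
   ('a \<Rightarrow> ('a, 'e) tangent \<Rightarrow> ('a, 'e) tangent \<Rightarrow> real) \<Rightarrow> nat \<Rightarrow>
   (nat \<Rightarrow> 'a \<Rightarrow> ('a, 'e) tangent) \<Rightarrow> real set \<Rightarrow> (real \<Rightarrow> 'a) \<Rightarrow> (real \<Rightarrow> real) \<Rightarrow> bool" where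
  "C_proper_tangent A g s \<xi> I \<gamma> l \<longleftrightarrow>
     (\<forall>t\<in>I. l differentiable (at t)) \<and> (\<forall>t\<in>I. l t \<noteq> 0) \<and>
     (\<forall>t\<in>I. laplacian_along A g \<gamma> (mean_curvature A g \<gamma>) t = l t *\<^sub>R (\<Sum>i\<in>{1..s}. \<xi> i (\<gamma> t)))"

end

theory Submission
  imports Defs "HOL-Computational_Algebra.Polynomial"
begin

text \<open>Write \<open>T = E\<^sub>1\<close> and \<open>\<kappa> = \<kappa>\<^sub>1\<close>.  The Frenet equations give
  \<open>\<Delta>H = 3\<kappa>\<kappa>' T + (\<kappa>\<^sup>3 - \<kappa>'') E\<^sub>2\<close>, and \<open>T\<close> is orthogonal to every \<open>\<xi>\<^sub>i\<close>.  So if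
  \<open>\<Delta>H = \<lambda> \<Sum>\<xi>\<^sub>i\<close>, then \<open>\<kappa>\<close> is constant and \<open>\<kappa>\<^sup>3 E\<^sub>2 = \<lambda> \<Sum>\<xi>\<^sub>i\<close>; comparing norms and using that
  \<open>\<lambda>\<close> has constant sign determines \<open>E\<^sub>2\<close> and \<open>\<lambda>\<close>.  The structure equation, applied to \<open>\<xi>\<^sub>j\<close>, yields
  \<open>g(\<nabla>\<^sub>T \<xi>\<^sub>j, T) = \<beta>\<^sub>j\<close> and \<open>g(\<nabla>\<^sub>T \<xi>\<^sub>j, fT) = -\<alpha>\<^sub>j\<close>.  Differentiating \<open>g(T, \<xi>\<^sub>j) = 0\<close> then gives every
  \<open>\<beta>\<^sub>j\<close>, and the \<open>fT\<close>-component of \<open>\<nabla>\<^sub>T E\<^sub>2 = -\<kappa> T\<close> gives \<open>\<Sum>\<alpha>\<^sub>i = 0\<close>.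

  The structure equation speaks about global vector fields only, so \<open>T\<close> at a point has to be
  extended by means of a bump function; and \<open>f\<close> is only controlled on tangent vectors, so the
  transformation law of the Christoffel symbols is needed to see that \<open>\<nabla>\<^sub>T \<xi>\<^sub>j\<close> is one.\<close>

section \<open>Calculus of smooth maps\<close>

text \<open>A derivative at a point of an open set depends only on nearby values, so the derivatives
  of \<open>f\<close> and \<open>g\<close> agree on \<open>S\<close> as well and the induction
  passes to them.\<close>

lemma Ck_on_cong:
  assumes "open S" "\<And>x. x \<in> S \<Longrightarrow> f x = g x" "Ck_on k S f"
  shows "Ck_on k S g"
  using assms(2,3)
proof (induction k arbitrary: f g)
  case 0
  then show ?case by (auto cong: continuous_on_cong)
next
  case (Suc k)
  have d: "(g has_derivative frechet_derivative f (at x)) (at x)" if "x \<in> S" for x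
    using Suc.prems that assms(1)
    by (intro has_derivative_transform_within_open[of f _ x UNIV S g])
       (auto simp: frechet_derivative_works[symmetric])
  have e: "frechet_derivative f (at x) = frechet_derivative g (at x)" if "x \<in> S" for x
    using d[OF that] frechet_derivative_at by blast
  have "Ck_on k S (\<lambda>x. frechet_derivative g (at x) v)" for v
    using Suc.IH[of "\<lambda>x. frechet_derivative f (at x) v"] Suc.prems(2) e by simp
  then show ?case using d by (auto simp: differentiable_def)
qed

text \<open>Each level of \<open>Ck_on\<close> is a condition at single points, apart from
  continuity, which is local for open sets. This permits different formulas on the members of an
  open cover.\<close>

lemma Ck_on_locally:
  assumes "\<And>x. x \<in> S \<Longrightarrow> \<exists>U. open U \<and> x \<in> U \<and> Ck_on k U f"
  shows "Ck_on k S f"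
  using assms
proof (induction k arbitrary: f)
  case 0
  show ?case
    unfolding Ck_on.simps
  proof (intro continuous_at_imp_continuous_on ballI)
    fix x assume "x \<in> S"
    then obtain U where "open U" "x \<in> U" "continuous_on U f" using 0 by force
    then show "isCont f x" by (simp add: continuous_on_eq_continuous_at)
  qed
next
  case (Suc k)
  have "Ck_on k S (\<lambda>x. frechet_derivative f (at x) v)" for v
    using Suc.prems by (intro Suc.IH) fastforce
  then show ?case using Suc.prems by fastforce
qed

lemma Ck_on_SucD: "Ck_on (Suc k) S f \<Longrightarrow> Ck_on k S f"
proof (induction k arbitrary: f)
  case 0
  then show ?case
    by (auto intro!: continuous_at_imp_continuous_on differentiable_imp_continuous_within)
next
  case (Suc k)
  then show ?case by (metis Ck_on.simps(2))
qed

lemma Ck_on_const: "Ck_on k S (\<lambda>x. c)"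
  by (induction k arbitrary: c) auto

text \<open>Any known derivative \<open>f'\<close> may replace \<open>frechet_derivative\<close>,
  with which it agrees by uniqueness.\<close>

lemma Ck_on_SucI:
  assumes "open S" "\<And>x. x \<in> S \<Longrightarrow> (f has_derivative f' x) (at x)"
    and "\<And>v. Ck_on k S (\<lambda>x. f' x v)"
  shows "Ck_on (Suc k) S f"
proof -
  have "f' x = frechet_derivative f (at x)" if "x \<in> S" for x
    using assms(2)[OF that] frechet_derivative_at by blast
  then show ?thesis
    using assms Ck_on_cong[OF assms(1) _ assms(3)]
    by (auto simp: differentiable_def)
qed

lemma Ck_on_Suc_has_derivative:
  assumes "Ck_on (Suc k) S f" "x \<in> S"
  shows "(f has_derivative frechet_derivative f (at x)) (at x)"
  using assms by (auto simp: frechet_derivative_works[symmetric])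

lemma Ck_on_bounded_linear:
  assumes "bounded_linear h" "open S"
  shows "Ck_on k S f \<Longrightarrow> Ck_on k S (\<lambda>x. h (f x))"
proof (induction k arbitrary: f)
  case 0
  then show ?case
    using bounded_linear.continuous_on[OF assms(1)] by auto
next
  case (Suc k)
  show ?case
    by (rule Ck_on_SucI[OF assms(2) bounded_linear.has_derivative[OF assms(1) Ck_on_Suc_has_derivative[OF Suc.prems]]])
      (use Suc in auto)
qed

lemma Ck_on_add:
  assumes "open S"
  shows "Ck_on k S f \<Longrightarrow> Ck_on k S g \<Longrightarrow> Ck_on k S (\<lambda>x. f x + g x)"
proof (induction k arbitrary: f g)
  case (Suc k)
  show ?case
    by (rule Ck_on_SucI[OF assms has_derivative_add[OF Ck_on_Suc_has_derivative[OF Suc.prems(1)] Ck_on_Suc_has_derivative[OF Suc.prems(2)]]])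
      (use Suc in auto)
qed (auto intro: continuous_on_add)

text \<open>Leibniz rule: the derivative is a sum of two products of the same kind, each with one
  undifferentiated factor. That factor is lowered from \<open>Suc k\<close> to \<open>k\<close>
  before the induction hypothesis applies.\<close>

lemma Ck_on_bilinear:
  assumes "bounded_bilinear h" "open S"
  shows "Ck_on k S f \<Longrightarrow> Ck_on k S g \<Longrightarrow> Ck_on k S (\<lambda>x. h (f x) (g x))"
proof (induction k arbitrary: f g)
  case 0
  then show ?case using bounded_bilinear.continuous_on[OF assms(1)] by auto
next
  case (Suc k)
  show ?case
  proof (rule Ck_on_SucI[OF assms(2) bounded_bilinear.FDERIV[OF assms(1) Ck_on_Suc_has_derivative[OF Suc.prems(1)] Ck_on_Suc_has_derivative[OF Suc.prems(2)]]])
    fix v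
    show "Ck_on k S (\<lambda>x. h (f x) (frechet_derivative g (at x) v) + h (frechet_derivative f (at x) v) (g x))"
      using Suc.prems Suc.prems[THEN Ck_on_SucD]
      by (intro Ck_on_add[OF assms(2)] Suc.IH) auto
  qed
qed

lemma Ck_on_sum:
  assumes "open S" "\<And>i. i \<in> J \<Longrightarrow> Ck_on k S (f i)"
  shows "Ck_on k S (\<lambda>x. \<Sum>i\<in>J. f i x)"
  using assms(2)
  by (induction J rule: infinite_finite_induct) (auto intro: Ck_on_const Ck_on_add assms(1))

text \<open>Trades a varying argument for fixed basis vectors with scalar coefficients, because
  smoothness of derivatives and tensors is given for fixed arguments only.\<close>

lemma linear_basis_sum:
  fixes h :: "'b::euclidean_space \<Rightarrow> 'c::real_vector"
  assumes "linear h"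
  shows "h v = (\<Sum>b\<in>Basis. (v \<bullet> b) *\<^sub>R h b)"
proof -
  have "h v = h (\<Sum>b\<in>Basis. (v \<bullet> b) *\<^sub>R b)" by (simp add: euclidean_representation)
  also have "\<dots> = (\<Sum>b\<in>Basis. (v \<bullet> b) *\<^sub>R h b)"
    by (simp add: linear_sum[OF assms] linear_scale[OF assms])
  finally show ?thesis .
qed

text \<open>The chain rule differentiates \<open>h\<close> in the direction
  \<open>frechet_derivative f (at x) v\<close>, which moves with \<open>x\<close>, whereas
  \<open>Ck_on\<close> speaks of fixed directions. Expanding this direction over
  \<open>Basis\<close> bridges the gap; here the finite dimension of the middle space
  enters.\<close>

lemma Ck_on_compose:
  fixes h :: "'b::euclidean_space \<Rightarrow> 'c::real_normed_vector"
  assumes S: "open S"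
  shows "Ck_on k T h \<Longrightarrow> Ck_on k S f \<Longrightarrow> f ` S \<subseteq> T \<Longrightarrow> Ck_on k S (\<lambda>x. h (f x))"
proof (induction k arbitrary: h)
  case 0
  then show ?case by (auto intro: continuous_on_compose2)
next
  case (Suc k)
  have d: "((\<lambda>x. h (f x)) has_derivative
      (\<lambda>v. frechet_derivative h (at (f x)) (frechet_derivative f (at x) v))) (at x)" if "x \<in> S" for x
    using diff_chain_at[OF Ck_on_Suc_has_derivative[OF Suc.prems(2) that] Ck_on_Suc_has_derivative[OF Suc.prems(1), of "f x"]]
      that Suc.prems(3) by (auto simp: o_def)
  have e: "frechet_derivative h (at (f x)) w =
      (\<Sum>b\<in>Basis. (w \<bullet> b) *\<^sub>R frechet_derivative h (at (f x)) b)" if "x \<in> S" for x w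
    using Suc.prems(1,3) that by (intro linear_basis_sum linear_frechet_derivative) auto
  show ?case
  proof (rule Ck_on_SucI[OF S d])
    fix v
    have "Ck_on k S (\<lambda>x. (\<Sum>b\<in>Basis. (frechet_derivative f (at x) v \<bullet> b) *\<^sub>R frechet_derivative h (at (f x)) b))"
      using Suc.prems Ck_on_SucD[OF Suc.prems(2)]
      by (intro Ck_on_sum[OF S] Ck_on_bilinear[OF bounded_bilinear_scaleR S]
          Ck_on_bounded_linear[OF bounded_linear_inner_left S] Suc.IH) auto
    then show "Ck_on k S (\<lambda>x. frechet_derivative h (at (f x)) (frechet_derivative f (at x) v))"
      by (rule Ck_on_cong[OF S, rotated]) (use e in simp)
  qed
qed

section \<open>Closure properties of smooth maps\<close>

named_theorems smooth_intros

lemma smooth_on_cong: "open S \<Longrightarrow> smooth_on S f \<Longrightarrow> (\<And>x. x \<in> S \<Longrightarrow> f x = g x) \<Longrightarrow> smooth_on S g"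
  unfolding smooth_on_def by (metis Ck_on_cong)

lemma smooth_on_locally:
  "(\<And>x. x \<in> S \<Longrightarrow> \<exists>U. open U \<and> x \<in> U \<and> smooth_on U f) \<Longrightarrow> smooth_on S f"
  unfolding smooth_on_def by (metis Ck_on_locally)

lemma smooth_on_differentiable: "smooth_on S f \<Longrightarrow> x \<in> S \<Longrightarrow> f differentiable (at x)"
  unfolding smooth_on_def by (metis Ck_on.simps(2))

lemma smooth_on_has_derivative:
  "smooth_on S f \<Longrightarrow> x \<in> S \<Longrightarrow> (f has_derivative frechet_derivative f (at x)) (at x)"
  using smooth_on_differentiable frechet_derivative_works by blast

lemma smooth_on_linear: "smooth_on S f \<Longrightarrow> x \<in> S \<Longrightarrow> linear (frechet_derivative f (at x))"
  using smooth_on_differentiable linear_frechet_derivative by blast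

lemma smooth_on_continuous: "smooth_on S f \<Longrightarrow> continuous_on S f"
  unfolding smooth_on_def by (metis Ck_on.simps(1))

lemma smooth_on_derivative [smooth_intros]:
  "smooth_on S f \<Longrightarrow> smooth_on S (\<lambda>x. frechet_derivative f (at x) v)"
  unfolding smooth_on_def by (metis Ck_on.simps(2))

lemma smooth_on_const [smooth_intros]: "smooth_on S (\<lambda>x. c)"
  by (simp add: smooth_on_def Ck_on_const)

lemma smooth_on_add [smooth_intros]:
  "smooth_on S f \<Longrightarrow> smooth_on S g \<Longrightarrow> open S \<Longrightarrow> smooth_on S (\<lambda>x. f x + g x)"
  by (simp add: smooth_on_def Ck_on_add)

lemma smooth_on_sum [smooth_intros]:
  "(\<And>i. i \<in> J \<Longrightarrow> smooth_on S (f i)) \<Longrightarrow> open S \<Longrightarrow> smooth_on S (\<lambda>x. \<Sum>i\<in>J. f i x)"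
  by (simp add: smooth_on_def Ck_on_sum)

lemma smooth_on_bounded_linear:
  "bounded_linear h \<Longrightarrow> smooth_on S f \<Longrightarrow> open S \<Longrightarrow> smooth_on S (\<lambda>x. h (f x))"
  by (simp add: smooth_on_def Ck_on_bounded_linear)

lemma smooth_on_ident [smooth_intros]: "smooth_on S (\<lambda>x. x)"
proof -
  have "Ck_on k S (\<lambda>x. x)" for k by (induction k) (auto intro: Ck_on_const)
  then show ?thesis by (simp add: smooth_on_def)
qed

lemma smooth_on_scaleR [smooth_intros]:
  "smooth_on S f \<Longrightarrow> smooth_on S g \<Longrightarrow> open S \<Longrightarrow> smooth_on S (\<lambda>x. f x *\<^sub>R g x)"
  by (simp add: smooth_on_def Ck_on_bilinear[OF bounded_bilinear_scaleR])

lemma smooth_on_mult [smooth_intros]: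
  fixes f :: "_ \<Rightarrow> 'b::real_normed_algebra"
  shows "smooth_on S f \<Longrightarrow> smooth_on S g \<Longrightarrow> open S \<Longrightarrow> smooth_on S (\<lambda>x. f x * g x)"
  by (simp add: smooth_on_def Ck_on_bilinear[OF bounded_bilinear_mult])

lemma smooth_on_inner [smooth_intros]:
  "smooth_on S f \<Longrightarrow> smooth_on S g \<Longrightarrow> open S \<Longrightarrow> smooth_on S (\<lambda>x. f x \<bullet> g x)"
  by (simp add: smooth_on_def Ck_on_bilinear[OF bounded_bilinear_inner])

lemma smooth_on_minus [smooth_intros]:
  "smooth_on S f \<Longrightarrow> open S \<Longrightarrow> smooth_on S (\<lambda>x. - f x)"
  by (rule smooth_on_bounded_linear[OF bounded_linear_minus[OF bounded_linear_ident]])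

lemma smooth_on_diff [smooth_intros]:
  "smooth_on S f \<Longrightarrow> smooth_on S g \<Longrightarrow> open S \<Longrightarrow> smooth_on S (\<lambda>x. f x - g x)"
  using smooth_on_add[of S f "\<lambda>x. - g x"] smooth_on_minus[of S g] by simp

lemma smooth_on_compose:
  fixes h :: "'b::euclidean_space \<Rightarrow> 'c::real_normed_vector"
  shows "smooth_on T h \<Longrightarrow> smooth_on S f \<Longrightarrow> open S \<Longrightarrow> f ` S \<subseteq> T \<Longrightarrow> smooth_on S (\<lambda>x. h (f x))"
  unfolding smooth_on_def by (blast intro: Ck_on_compose[where T = T])

section \<open>Symmetry of second derivatives\<close>

text \<open>The mean value theorem, applied along \<open>u\<close> and then along \<open>w\<close>,
  turns the second difference into \<open>t\<^sup>2\<close> times the second derivative at an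
  intermediate point; continuity at \<open>x\<close> finishes.\<close>

lemma second_derivative_as_limit:
  fixes h :: "'e::real_normed_vector \<Rightarrow> real"
  assumes "open S" "x \<in> S" "smooth_on S h" "e > 0"
  shows "\<exists>\<delta>>0. \<forall>t. 0 < t \<and> t < \<delta> \<longrightarrow>
    \<bar>(h (x + t *\<^sub>R u + t *\<^sub>R w) - h (x + t *\<^sub>R u) - h (x + t *\<^sub>R w) + h x) / t\<^sup>2 -
     frechet_derivative (\<lambda>x. frechet_derivative h (at x) u) (at x) w\<bar> < e"
proof -
  define h1 where "h1 = (\<lambda>x. frechet_derivative h (at x) u)"
  define h2 where "h2 = (\<lambda>x. frechet_derivative h1 (at x) w)"
  have s1: "smooth_on S h1" and s2: "smooth_on S h2"
    using assms by (auto simp: h1_def h2_def intro!: smooth_intros)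
  have "isCont h2 x"
    using smooth_on_continuous[OF s2] assms by (simp add: continuous_on_eq_continuous_at)
  then obtain d where d: "d > 0" "\<And>y. dist y x < d \<Longrightarrow> dist (h2 y) (h2 x) < e"
    using \<open>e > 0\<close> by (auto simp: continuous_at_eps_delta)
  obtain d' where d': "d' > 0" "ball x d' \<subseteq> S"
    using assms by (meson openE)
  \<comment> \<open>\<open>d'\<close> keeps the parallelogram inside \<open>S\<close> and
    \<open>d\<close> controls the variation of \<open>h2\<close>; the summand 1 keeps the
    denominator positive when \<open>u\<close> and \<open>w\<close> vanish.\<close>
  define \<delta> where "\<delta> = min d d' / (norm u + norm w + 1)"
  have pos: "norm u + norm w + 1 > 0" by (smt (verit) norm_ge_zero)
  have "\<delta> > 0" using pos d d' by (simp add: \<delta>_def)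
  moreover have "\<bar>(h (x + t *\<^sub>R u + t *\<^sub>R w) - h (x + t *\<^sub>R u) - h (x + t *\<^sub>R w) + h x) / t\<^sup>2 - h2 x\<bar> < e"
    if t: "0 < t" "t < \<delta>" for t
  proof -
    have near: "dist (x + (a * t) *\<^sub>R u + (b * t) *\<^sub>R w) x < min d d'"
      if "0 \<le> a" "a \<le> 1" "0 \<le> b" "b \<le> 1" for a b
    proof -
      have "dist (x + (a * t) *\<^sub>R u + (b * t) *\<^sub>R w) x \<le> (a * t) * norm u + (b * t) * norm w"
        using that t norm_triangle_ineq[of "(a * t) *\<^sub>R u" "(b * t) *\<^sub>R w"]
        by (simp add: dist_norm algebra_simps)
      also have "\<dots> \<le> t * norm u + t * norm w"
        using that t by (intro add_mono mult_right_mono) auto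
      also have "\<dots> < t * (norm u + norm w + 1)"
        using t by (simp add: algebra_simps)
      also have "\<dots> < min d d'"
        using t pos by (simp add: \<delta>_def pos_less_divide_eq)
      finally show ?thesis .
    qed
    have inS: "x + (a * t) *\<^sub>R u + (b * t) *\<^sub>R w \<in> S"
      if "0 \<le> a" "a \<le> 1" "0 \<le> b" "b \<le> 1" for a b
      using near[OF that] d' by (auto simp: mem_ball dist_commute)
    \<comment> \<open>\<open>k 1 - k 0\<close> is the second difference. The factors
      \<open>1 * t\<close> and \<open>0 * t\<close> are written out to match \<open>hd\<close> with
      \<open>b\<close> equal to 1 and 0.\<close>
    define k where "k a = h (x + (a * t) *\<^sub>R u + (1 * t) *\<^sub>R w) - h (x + (a * t) *\<^sub>R u + (0 * t) *\<^sub>R w)" for a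
    have hd: "((\<lambda>a. h (x + (a * t) *\<^sub>R u + (b * t) *\<^sub>R w)) has_real_derivative
        t * h1 (x + (a * t) *\<^sub>R u + (b * t) *\<^sub>R w)) (at a)"
      if "0 \<le> a" "a \<le> 1" "0 \<le> b" "b \<le> 1" for a b
    proof -
      have "((\<lambda>a. x + (a * t) *\<^sub>R u + (b * t) *\<^sub>R w) has_derivative (\<lambda>c. (c * t) *\<^sub>R u)) (at a)"
        by (auto intro!: derivative_eq_intros)
      from diff_chain_at[OF this smooth_on_has_derivative[OF assms(3) inS[OF that]]]
      have "((\<lambda>a. h (x + (a * t) *\<^sub>R u + (b * t) *\<^sub>R w)) has_derivative
        (\<lambda>c. c * (t * h1 (x + (a * t) *\<^sub>R u + (b * t) *\<^sub>R w)))) (at a)"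
        unfolding o_def h1_def linear_scale[OF smooth_on_linear[OF assms(3) inS[OF that]]]
        by (simp add: mult.assoc)
      then show ?thesis by (simp add: has_field_derivative_def mult_commute_abs)
    qed
    have hd1: "((\<lambda>b. h1 (x + (a * t) *\<^sub>R u + (b * t) *\<^sub>R w)) has_real_derivative
        t * h2 (x + (a * t) *\<^sub>R u + (b * t) *\<^sub>R w)) (at b)"
      if "0 \<le> a" "a \<le> 1" "0 \<le> b" "b \<le> 1" for a b
    proof -
      have "((\<lambda>b. x + (a * t) *\<^sub>R u + (b * t) *\<^sub>R w) has_derivative (\<lambda>c. (c * t) *\<^sub>R w)) (at b)"
        by (auto intro!: derivative_eq_intros)
      from diff_chain_at[OF this smooth_on_has_derivative[OF s1 inS[OF that]]]
      have "((\<lambda>b. h1 (x + (a * t) *\<^sub>R u + (b * t) *\<^sub>R w)) has_derivative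
        (\<lambda>c. c * (t * h2 (x + (a * t) *\<^sub>R u + (b * t) *\<^sub>R w)))) (at b)"
        unfolding o_def h2_def linear_scale[OF smooth_on_linear[OF s1 inS[OF that]]]
        by (simp add: mult.assoc)
      then show ?thesis by (simp add: has_field_derivative_def mult_commute_abs)
    qed
    have kd: "(k has_real_derivative (t * h1 (x + (a * t) *\<^sub>R u + (1 * t) *\<^sub>R w)
        - t * h1 (x + (a * t) *\<^sub>R u + (0 * t) *\<^sub>R w))) (at a)" if "0 \<le> a" "a \<le> 1" for a
      unfolding k_def using that by (intro DERIV_diff hd) auto
    obtain a where a: "0 < a" "a < 1" "k 1 - k 0 = (1 - 0) * (t * h1 (x + (a * t) *\<^sub>R u + (1 * t) *\<^sub>R w)
        - t * h1 (x + (a * t) *\<^sub>R u + (0 * t) *\<^sub>R w))"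
      using MVT2[of 0 1 k, OF _ kd] by auto
    obtain b where b: "0 < b" "b < 1" "h1 (x + (a * t) *\<^sub>R u + (1 * t) *\<^sub>R w) - h1 (x + (a * t) *\<^sub>R u + (0 * t) *\<^sub>R w)
        = (1 - 0) * (t * h2 (x + (a * t) *\<^sub>R u + (b * t) *\<^sub>R w))"
      using MVT2[of 0 1 "\<lambda>b. h1 (x + (a * t) *\<^sub>R u + (b * t) *\<^sub>R w)", OF _ hd1] a by auto
    have "k 1 - k 0 = t * (h1 (x + (a * t) *\<^sub>R u + (1 * t) *\<^sub>R w) - h1 (x + (a * t) *\<^sub>R u + (0 * t) *\<^sub>R w))"
      using a(3) by (simp add: right_diff_distrib)
    also have "\<dots> = t\<^sup>2 * h2 (x + (a * t) *\<^sub>R u + (b * t) *\<^sub>R w)"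
      unfolding b(3) by (simp add: power2_eq_square)
    finally have "(k 1 - k 0) / t\<^sup>2 = h2 (x + (a * t) *\<^sub>R u + (b * t) *\<^sub>R w)"
      using t by simp
    moreover have "h (x + t *\<^sub>R u + t *\<^sub>R w) - h (x + t *\<^sub>R u) - h (x + t *\<^sub>R w) + h x = k 1 - k 0"
      by (simp add: k_def)
    moreover have "dist (h2 (x + (a * t) *\<^sub>R u + (b * t) *\<^sub>R w)) (h2 x) < e"
      using a b near[of a b] by (intro d(2)) auto
    ultimately show ?thesis by (simp add: dist_real_def)
  qed
  ultimately show ?thesis by (auto simp: h2_def h1_def)
qed

text \<open>Schwarz's theorem: the second difference is unchanged when \<open>u\<close> and
  \<open>w\<close> are exchanged, so both iterated derivatives are limits of the same
  quotient.\<close>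

lemma second_derivative_symmetric_real:
  fixes h :: "'e::real_normed_vector \<Rightarrow> real"
  assumes "open S" "x \<in> S" "smooth_on S h"
  shows "frechet_derivative (\<lambda>x. frechet_derivative h (at x) u) (at x) w =
    frechet_derivative (\<lambda>x. frechet_derivative h (at x) w) (at x) u" (is "?a = ?b")
proof (rule ccontr)
  assume "?a \<noteq> ?b"
  define e where "e = \<bar>?a - ?b\<bar> / 2"
  have "e > 0" using \<open>?a \<noteq> ?b\<close> by (simp add: e_def)
  obtain d where d: "d > 0" "\<And>t. 0 < t \<Longrightarrow> t < d \<Longrightarrow>
    \<bar>(h (x + t *\<^sub>R u + t *\<^sub>R w) - h (x + t *\<^sub>R u) - h (x + t *\<^sub>R w) + h x) / t\<^sup>2 - ?a\<bar> < e"
    using second_derivative_as_limit[OF assms \<open>e > 0\<close>, of u w] by blast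
  obtain d' where d': "d' > 0" "\<And>t. 0 < t \<Longrightarrow> t < d' \<Longrightarrow>
    \<bar>(h (x + t *\<^sub>R w + t *\<^sub>R u) - h (x + t *\<^sub>R w) - h (x + t *\<^sub>R u) + h x) / t\<^sup>2 - ?b\<bar> < e"
    using second_derivative_as_limit[OF assms \<open>e > 0\<close>, of w u] by blast
  define t where "t = min d d' / 2"
  have t: "0 < t" "t < d" "t < d'" using d(1) d'(1) by (auto simp: t_def)
  define q where "q = (h (x + t *\<^sub>R u + t *\<^sub>R w) - h (x + t *\<^sub>R u) - h (x + t *\<^sub>R w) + h x) / t\<^sup>2"
  have "(h (x + t *\<^sub>R w + t *\<^sub>R u) - h (x + t *\<^sub>R w) - h (x + t *\<^sub>R u) + h x) / t\<^sup>2 = q"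
    unfolding q_def add.assoc add.commute[of "t *\<^sub>R w"] by simp
  then have "\<bar>q - ?a\<bar> < e" "\<bar>q - ?b\<bar> < e"
    using d(2)[OF t(1,2)] d'(2)[OF t(1,3)] unfolding q_def by metis+
  moreover have "\<bar>?a - ?b\<bar> \<le> \<bar>q - ?a\<bar> + \<bar>q - ?b\<bar>" by arith
  ultimately show False unfolding e_def by (simp add: field_simps)
qed

text \<open>Taking a component commutes with differentiation, so the real-valued case applies to
  each \<open>h x \<bullet> b\<close>.\<close>

lemma second_derivative_symmetric:
  fixes h :: "'e::real_normed_vector \<Rightarrow> 'b::euclidean_space"
  assumes "open S" "x \<in> S" "smooth_on S h"
  shows "frechet_derivative (\<lambda>x. frechet_derivative h (at x) u) (at x) w =
    frechet_derivative (\<lambda>x. frechet_derivative h (at x) w) (at x) u"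
proof (rule euclidean_eqI)
  fix b :: 'b assume "b \<in> Basis"
  have comp: "frechet_derivative (\<lambda>x. k x \<bullet> b) (at y) v = frechet_derivative k (at y) v \<bullet> b"
    if "smooth_on S k" "y \<in> S" for k :: "'e \<Rightarrow> 'b" and y v
    using bounded_linear.has_derivative[OF bounded_linear_inner_left smooth_on_has_derivative[OF that], of b]
    by (metis frechet_derivative_at)
  have two: "frechet_derivative (\<lambda>x. frechet_derivative h (at x) u) (at x) w \<bullet> b =
     frechet_derivative (\<lambda>x. frechet_derivative (\<lambda>x. h x \<bullet> b) (at x) u) (at x) w" for u w
  proof -
    have s: "smooth_on S (\<lambda>x. frechet_derivative h (at x) u)" using assms by (intro smooth_intros)
    have "((\<lambda>x. frechet_derivative h (at x) u \<bullet> b) has_derivative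
       (\<lambda>w. frechet_derivative (\<lambda>x. frechet_derivative h (at x) u) (at x) w \<bullet> b)) (at x)"
      by (rule bounded_linear.has_derivative[OF bounded_linear_inner_left smooth_on_has_derivative[OF s assms(2)]])
    then have "((\<lambda>x. frechet_derivative (\<lambda>x. h x \<bullet> b) (at x) u) has_derivative
       (\<lambda>w. frechet_derivative (\<lambda>x. frechet_derivative h (at x) u) (at x) w \<bullet> b)) (at x)"
      by (rule has_derivative_transform_within_open[OF _ assms(1,2)]) (simp add: comp[OF assms(3)])
    then show ?thesis by (metis frechet_derivative_at)
  qed
  show "frechet_derivative (\<lambda>x. frechet_derivative h (at x) u) (at x) w \<bullet> b =
    frechet_derivative (\<lambda>x. frechet_derivative h (at x) w) (at x) u \<bullet> b"
    unfolding two using assms by (intro second_derivative_symmetric_real smooth_intros)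
qed

section \<open>A smooth function vanishing on a half-line\<close>

text \<open>For \<open>p = 1\<close> this is the classical flat function exp(-1/t), continued by 0.
  The polynomial factor in 1/t makes the family closed under differentiation.\<close>

definition flat_exp :: "real poly \<Rightarrow> real \<Rightarrow> real" where
  "flat_exp p t = (if t > 0 then poly p (inverse t) * exp (- inverse t) else 0)"

text \<open>With x = 1/t this is the decay of each \<open>x ^ i * exp (- x)\<close> at
  infinity.\<close>

lemma flat_exp_tendsto_0: "((\<lambda>t. poly p (inverse t) * exp (- inverse t)) \<longlongrightarrow> (0::real)) (at_right 0)"
proof -
  have "((\<lambda>x::real. poly p x * exp (- x)) \<longlongrightarrow> (\<Sum>i\<le>degree p. coeff p i * 0)) at_top"
    unfolding poly_altdef sum_distrib_right mult.assoc
    by (intro tendsto_intros tendsto_power_div_exp_0[unfolded divide_inverse exp_minus[symmetric]])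
  then have "((\<lambda>x::real. poly p x * exp (- x)) \<longlongrightarrow> 0) at_top" by simp
  from filterlim_compose[OF this filterlim_inverse_at_top_right] show ?thesis .
qed

text \<open>For \<open>t > 0\<close> and x = 1/t, product and chain rule give x^2 (p(x) - p'(x))
  exp(-x), whence the new polynomial. Only \<open>t = 0\<close> requires a limit.\<close>

lemma flat_exp_has_derivative:
  "(flat_exp p has_real_derivative flat_exp (monom 1 2 * (p - pderiv p)) t) (at t)"
proof -
  consider "t > 0" | "t < 0" | "t = 0" by linarith
  then show ?thesis
  proof cases
    case 1
    have "((\<lambda>t. poly p (inverse t) * exp (- inverse t)) has_real_derivative
       flat_exp (monom 1 2 * (p - pderiv p)) t) (at t)"
      using 1 by (auto intro!: derivative_eq_intros DERIV_chain2[OF poly_DERIV]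
          simp: flat_exp_def poly_monom power2_eq_square algebra_simps)
    then show ?thesis
      by (rule has_field_derivative_transform_within_open[of _ _ _ "{0<..}"])
        (use 1 in \<open>auto simp: flat_exp_def\<close>)
  next
    case 2
    have "((\<lambda>t. 0) has_real_derivative flat_exp (monom 1 2 * (p - pderiv p)) t) (at t)"
      using 2 by (auto simp: flat_exp_def)
    then show ?thesis
      by (rule has_field_derivative_transform_within_open[of _ _ _ "{..<0}"])
        (use 2 in \<open>auto simp: flat_exp_def\<close>)
  next
    case 3
    have "((\<lambda>h. (flat_exp p (0 + h) - flat_exp p 0) / h) \<longlongrightarrow> 0) (at 0)"
    proof (rule filterlim_split_at_real)
      show "((\<lambda>h. (flat_exp p (0 + h) - flat_exp p 0) / h) \<longlongrightarrow> 0) (at_left 0)"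
        by (rule tendsto_eventually)
          (auto simp: flat_exp_def eventually_at_filter intro!: always_eventually)
      \<comment> \<open>Dividing by \<open>h\<close> multiplies the polynomial by the variable 1/h,
        which is what \<open>pCons 0 p\<close> expresses.\<close>
      have "((\<lambda>t. poly (pCons 0 p) (inverse t) * exp (- inverse t)) \<longlongrightarrow> (0::real)) (at_right 0)"
        by (rule flat_exp_tendsto_0)
      then show "((\<lambda>h. (flat_exp p (0 + h) - flat_exp p 0) / h) \<longlongrightarrow> 0) (at_right 0)"
        by (rule Lim_transform_eventually)
          (auto simp: flat_exp_def eventually_at_filter divide_inverse intro!: always_eventually)
    qed
    then show ?thesis using 3 by (simp add: DERIV_def flat_exp_def)
  qed
qed

lemma smooth_on_flat_exp: "smooth_on UNIV (flat_exp p)"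
proof -
  have "Ck_on k UNIV (flat_exp p)" for k
  proof (induction k arbitrary: p)
    case 0
    show ?case
      using flat_exp_has_derivative[of p] DERIV_isCont
      by (auto simp: continuous_on_eq_continuous_at)
  next
    case (Suc k)
    show ?case
    proof (rule Ck_on_SucI)
      show "(flat_exp p has_derivative (\<lambda>v. flat_exp (monom 1 2 * (p - pderiv p)) t * v)) (at t)" for t
        using flat_exp_has_derivative[of p t] by (simp add: has_field_derivative_def)
      show "Ck_on k UNIV (\<lambda>t. flat_exp (monom 1 2 * (p - pderiv p)) t * v)" for v
        by (intro Ck_on_bounded_linear[OF bounded_linear_mult_left] Suc.IH) auto
    qed simp
  qed
  then show ?thesis by (simp add: smooth_on_def)
qed


section \<open>Charts, tangent vectors and vector fields\<close>

context smooth_manifold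
begin

lemma open_chart_dom: "c \<in> A \<Longrightarrow> open (chart_dom c)"
  and open_chart_image: "c \<in> A \<Longrightarrow> open (chart_image c)"
  and chart_homeomorphism:
    "c \<in> A \<Longrightarrow> homeomorphism (chart_dom c) (chart_image c) (chart_map c) (chart_inv c)"
  using charts by (auto simp: is_chart_def)

lemma chart_inv_map: "c \<in> A \<Longrightarrow> p \<in> chart_dom c \<Longrightarrow> chart_inv c (chart_map c p) = p"
  and chart_map_inv: "c \<in> A \<Longrightarrow> x \<in> chart_image c \<Longrightarrow> chart_map c (chart_inv c x) = x"
  and chart_inv_in_dom: "c \<in> A \<Longrightarrow> x \<in> chart_image c \<Longrightarrow> chart_inv c x \<in> chart_dom c"
  and chart_map_in_image: "c \<in> A \<Longrightarrow> p \<in> chart_dom c \<Longrightarrow> chart_map c p \<in> chart_image c"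
  and chart_inv_continuous: "c \<in> A \<Longrightarrow> continuous_on (chart_image c) (chart_inv c)"
  using chart_homeomorphism[of c] by (auto simp: homeomorphism_def)

lemma charts_at_iff: "c \<in> charts_at A p \<longleftrightarrow> c \<in> A \<and> p \<in> chart_dom c"
  by (auto simp: charts_at_def)

lemma charts_at_chart_inv: "c \<in> A \<Longrightarrow> x \<in> chart_image c \<Longrightarrow> c \<in> charts_at A (chart_inv c x)"
  by (simp add: charts_at_iff chart_inv_in_dom)

lemma ex_chart_at: "\<exists>c. c \<in> charts_at A p"
  using cover by (auto simp: charts_at_iff)

section \<open>Coordinate overlaps and transition maps\<close>

text \<open>The coordinate set on which the compatibility axiom makes \<open>transition c d\<close>
  smooth.\<close>

definition overlap where "overlap c d = chart_map c ` (chart_dom c \<inter> chart_dom d)"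

lemma overlap_iff:
  assumes cd: "c \<in> A" "d \<in> A"
  shows "x \<in> overlap c d \<longleftrightarrow> x \<in> chart_image c \<and> chart_inv c x \<in> chart_dom d"
proof
  show "x \<in> overlap c d \<Longrightarrow> x \<in> chart_image c \<and> chart_inv c x \<in> chart_dom d"
    using cd by (auto simp: overlap_def chart_map_in_image chart_inv_map)
  assume x: "x \<in> chart_image c \<and> chart_inv c x \<in> chart_dom d"
  then have "x = chart_map c (chart_inv c x)" "chart_inv c x \<in> chart_dom c \<inter> chart_dom d"
    using cd by (auto simp: chart_map_inv chart_inv_in_dom)
  then show "x \<in> overlap c d" unfolding overlap_def by blast
qed

lemma chart_map_in_overlap: "c \<in> charts_at A p \<Longrightarrow> d \<in> charts_at A p \<Longrightarrow> chart_map c p \<in> overlap c d"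
  by (auto simp: charts_at_iff overlap_def)

lemma open_preimage_chart_inv:
  assumes "c \<in> A" "open U"
  shows "open {x \<in> chart_image c. chart_inv c x \<in> U}"
proof -
  have "{x \<in> chart_image c. chart_inv c x \<in> U} = chart_inv c -` U \<inter> chart_image c" by auto
  then show ?thesis
    using chart_inv_continuous[OF assms(1)] assms(2)
    by (metis continuous_on_open_vimage open_chart_image[OF assms(1)])
qed

lemma open_overlap: "c \<in> A \<Longrightarrow> d \<in> A \<Longrightarrow> open (overlap c d)"
proof -
  assume cd: "c \<in> A" "d \<in> A"
  have "overlap c d = {x \<in> chart_image c. chart_inv c x \<in> chart_dom d}"
    using overlap_iff[OF cd] by blast
  then show ?thesis using open_preimage_chart_inv[OF cd(1) open_chart_dom[OF cd(2)]] by simp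
qed

lemma transition_smooth: "c \<in> A \<Longrightarrow> d \<in> A \<Longrightarrow> smooth_on (overlap c d) (transition c d)"
  using compatible by (simp add: overlap_def)

lemma transition_map: "c \<in> A \<Longrightarrow> p \<in> chart_dom c \<Longrightarrow> transition c d (chart_map c p) = chart_map d p"
  by (simp add: transition_def chart_inv_map)

lemma transition_in_overlap:
  "c \<in> A \<Longrightarrow> d \<in> A \<Longrightarrow> x \<in> overlap c d \<Longrightarrow> transition c d x \<in> overlap d c"
  by (auto simp: transition_map overlap_def)

lemma transition_has_derivative:
  "c \<in> charts_at A p \<Longrightarrow> d \<in> charts_at A p \<Longrightarrow> (transition c d has_derivative
    frechet_derivative (transition c d) (at (chart_map c p))) (at (chart_map c p))"
  by (rule smooth_on_has_derivative[OF transition_smooth chart_map_in_overlap]) (auto simp: charts_at_iff)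

lemma transition_linear:
  "c \<in> charts_at A p \<Longrightarrow> d \<in> charts_at A p \<Longrightarrow>
    linear (frechet_derivative (transition c d) (at (chart_map c p)))"
  using transition_has_derivative has_derivative_linear by blast

lemma transition_derivative_self:
  assumes "c \<in> charts_at A p"
  shows "frechet_derivative (transition c c) (at (chart_map c p)) u = u"
proof -
  have c: "c \<in> A" "p \<in> chart_dom c" using assms by (auto simp: charts_at_iff)
  have "(transition c c has_derivative (\<lambda>x. x)) (at (chart_map c p))"
    by (rule has_derivative_transform_within_open[OF has_derivative_ident open_chart_image[OF c(1)]])
      (use c in \<open>auto simp: chart_map_in_image transition_def chart_map_inv\<close>)
  then show ?thesis by (metis frechet_derivative_at)
qed

text \<open>Chain rule for \<open>transition c e\<close>, which near \<open>chart_map c p\<close> is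
  \<open>transition d e\<close> after \<open>transition c d\<close>. With \<open>e = c\<close> it
  shows that the differentials are invertible.\<close>

lemma transition_derivative_cocycle:
  assumes "c \<in> charts_at A p" "d \<in> charts_at A p" "e \<in> charts_at A p"
  shows "frechet_derivative (transition d e) (at (chart_map d p))
      (frechet_derivative (transition c d) (at (chart_map c p)) u) =
    frechet_derivative (transition c e) (at (chart_map c p)) u"
proof -
  have A: "c \<in> A" "d \<in> A" "e \<in> A" "p \<in> chart_dom c" "p \<in> chart_dom d"
    using assms by (auto simp: charts_at_iff)
  have d: "(transition d e has_derivative frechet_derivative (transition d e) (at (chart_map d p)))
      (at (transition c d (chart_map c p)))"
    using transition_has_derivative[OF assms(2,3)] A by (simp add: transition_map)
  have "(transition c e has_derivative
      frechet_derivative (transition d e) (at (chart_map d p)) \<circ>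
      frechet_derivative (transition c d) (at (chart_map c p))) (at (chart_map c p))"
    by (rule has_derivative_transform_within_open
        [OF diff_chain_at[OF transition_has_derivative[OF assms(1,2)] d] open_overlap[OF A(1,2)]])
      (use A assms in \<open>auto simp: chart_map_in_overlap overlap_def transition_map\<close>)
  then show ?thesis by (metis frechet_derivative_at comp_apply)
qed

section \<open>Tangent vectors in coordinates\<close>

lemma coord_tangent_in_tangent_space:
  "c \<in> charts_at A p \<Longrightarrow> coord_tangent A c p u \<in> tangent_space A p"
  by (auto simp: tangent_space_def coord_tangent_def transition_derivative_cocycle)

lemma coord_tangent_same: "c \<in> charts_at A p \<Longrightarrow> coord_tangent A c p u c = u"
  by (simp add: coord_tangent_def transition_derivative_self)

lemma tangent_space_transition:
  "v \<in> tangent_space A p \<Longrightarrow> c \<in> charts_at A p \<Longrightarrow> d \<in> charts_at A p \<Longrightarrow>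
    v d = frechet_derivative (transition c d) (at (chart_map c p)) (v c)"
  unfolding tangent_space_def by blast

lemma tangent_space_0: "v \<in> tangent_space A p \<Longrightarrow> c \<notin> charts_at A p \<Longrightarrow> v c = 0"
  unfolding tangent_space_def by blast

lemma tangent_spaceI:
  assumes "\<And>c. c \<notin> charts_at A p \<Longrightarrow> v c = 0"
    and "\<And>c d. c \<in> charts_at A p \<Longrightarrow> d \<in> charts_at A p \<Longrightarrow>
      v d = frechet_derivative (transition c d) (at (chart_map c p)) (v c)"
  shows "v \<in> tangent_space A p"
  unfolding tangent_space_def using assms by blast

lemma coord_tangent_coord:
  assumes "v \<in> tangent_space A p" "c \<in> charts_at A p"
  shows "coord_tangent A c p (v c) = v"
proof
  show "coord_tangent A c p (v c) d = v d" for d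
    using tangent_space_transition[OF assms, of d] tangent_space_0[OF assms(1), of d]
    unfolding coord_tangent_def by presburger
qed

lemma coord_tangent_transition:
  assumes "c \<in> charts_at A p" "d \<in> charts_at A p"
  shows "coord_tangent A d p (frechet_derivative (transition c d) (at (chart_map c p)) u) =
    coord_tangent A c p u"
  using coord_tangent_coord[OF coord_tangent_in_tangent_space[OF assms(1)] assms(2), of u] assms
  by (simp add: coord_tangent_def)

lemma coord_tangent_add: "c \<in> charts_at A p \<Longrightarrow>
    coord_tangent A c p (u + w) = coord_tangent A c p u + coord_tangent A c p w"
  by (auto simp: coord_tangent_def fun_eq_iff linear_add[OF transition_linear])

lemma coord_tangent_scaleR: "c \<in> charts_at A p \<Longrightarrow>
    coord_tangent A c p (r *\<^sub>R u) = r *\<^sub>R coord_tangent A c p u"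
  by (auto simp: coord_tangent_def fun_eq_iff linear_scale[OF transition_linear])

lemma tangent_space_add:
  assumes "v \<in> tangent_space A p" "w \<in> tangent_space A p"
  shows "v + w \<in> tangent_space A p"
proof (rule tangent_spaceI)
  fix c assume "c \<notin> charts_at A p"
  then show "(v + w) c = 0" using assms[THEN tangent_space_0] by simp
next
  fix c d assume cd: "c \<in> charts_at A p" "d \<in> charts_at A p"
  show "(v + w) d = frechet_derivative (transition c d) (at (chart_map c p)) ((v + w) c)"
    using tangent_space_transition[OF assms(1) cd] tangent_space_transition[OF assms(2) cd]
    unfolding plus_fun_apply linear_add[OF transition_linear[OF cd]] by (rule arg_cong2)
qed

lemma tangent_space_zero: "0 \<in> tangent_space A p"
  by (rule tangent_spaceI) (simp_all add: linear_0[OF transition_linear])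

lemma tangent_space_scaleR:
  assumes "v \<in> tangent_space A p"
  shows "r *\<^sub>R v \<in> tangent_space A p"
proof (rule tangent_spaceI)
  fix c assume "c \<notin> charts_at A p"
  then show "(r *\<^sub>R v) c = 0" using assms tangent_space_0[of _ p c] by simp
next
  fix c d assume cd: "c \<in> charts_at A p" "d \<in> charts_at A p"
  show "(r *\<^sub>R v) d = frechet_derivative (transition c d) (at (chart_map c p)) ((r *\<^sub>R v) c)"
    using tangent_space_transition[OF assms(1) cd]
    unfolding scaleR_fun_apply linear_scale[OF transition_linear[OF cd]] by (rule arg_cong)
qed

lemma tangent_space_sum:
  "(\<And>i. i \<in> J \<Longrightarrow> v i \<in> tangent_space A p) \<Longrightarrow> (\<Sum>i\<in>J. v i) \<in> tangent_space A p"
  by (induction J rule: infinite_finite_induct) (auto simp: tangent_space_zero tangent_space_add)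

text \<open>The coordinates of \<open>v\<close> in a chart are extended as constants and multiplied by a bump
  function supported in a compact subset of the chart domain.\<close>

lemma ex_vector_field_extending:
  assumes v: "v \<in> tangent_space A p"
  shows "\<exists>X. vector_field A X \<and> X p = v"
proof -
  obtain c where c: "c \<in> charts_at A p" using ex_chart_at by blast
  then have cA: "c \<in> A" "p \<in> chart_dom c" by (auto simp: charts_at_iff)
  define x0 where "x0 = chart_map c p"
  obtain r where r: "r > 0" "cball x0 r \<subseteq> chart_image c"
    using open_chart_image[OF cA(1)] chart_map_in_image[OF cA] unfolding x0_def
    by (meson open_contains_cball)
  \<comment> \<open>Positive exactly inside the open ball of radius \<open>r\<close>, and divided by
    its value at the centre so that \<open>bump x0 = 1\<close>.\<close>
  define bump where "bump x = flat_exp 1 (r\<^sup>2 - (x - x0) \<bullet> (x - x0)) * inverse (flat_exp 1 (r\<^sup>2))" for x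
  have bump_smooth: "smooth_on S bump" if "open S" for S
    unfolding bump_def
    by (intro smooth_intros smooth_on_compose[OF smooth_on_flat_exp] that) auto
  have bump_x0: "bump x0 = 1"
    using r by (simp add: bump_def flat_exp_def)
  have bump_0: "bump x = 0" if "x \<notin> cball x0 r" for x
  proof -
    have "r < norm (x - x0)" using that by (simp add: dist_norm norm_minus_commute)
    then have "r\<^sup>2 < (norm (x - x0))\<^sup>2" using r by (intro power_strict_mono) auto
    then show ?thesis by (simp add: bump_def flat_exp_def power2_norm_eq_inner)
  qed
  define X where "X q = (if q \<in> chart_dom c then bump (chart_map c q) *\<^sub>R coord_tangent A c q (v c) else 0)" for q
  \<comment> \<open>A compact set in a Hausdorff space is closed. Hence the chart domain of
    \<open>c\<close> and the complement of \<open>K\<close> form an open cover, and \<open>X\<close>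
    has a smooth expression on each of the two.\<close>
  define K where "K = chart_inv c ` cball x0 r"
  have "compact K" unfolding K_def
    by (intro compact_continuous_image continuous_on_subset[OF chart_inv_continuous[OF cA(1)]] r compact_cball)
  then have "open (- K)" by (simp add: compact_imp_closed open_Compl)
  have X0: "X q = 0" if "q \<notin> K" for q
  proof (cases "q \<in> chart_dom c")
    case True
    have "chart_map c q \<notin> cball x0 r"
    proof
      assume "chart_map c q \<in> cball x0 r"
      then have "q \<in> K" unfolding K_def using chart_inv_map[OF cA(1) True] by (metis imageI)
      then show False using that by simp
    qed
    then show ?thesis by (simp add: X_def bump_0)
  qed (simp add: X_def)
  have "X q \<in> tangent_space A q" for q
    using cA by (auto simp: X_def charts_at_iff tangent_space_zero
        intro!: tangent_space_scaleR coord_tangent_in_tangent_space)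
  moreover have "smooth_on (chart_image d) (\<lambda>x. X (chart_inv d x) d)" if d: "d \<in> A" for d
  proof (rule smooth_on_locally)
    fix x assume x: "x \<in> chart_image d"
    show "\<exists>U. open U \<and> x \<in> U \<and> smooth_on U (\<lambda>x. X (chart_inv d x) d)"
    proof (cases "chart_inv d x \<in> chart_dom c")
      case True
      let ?U = "overlap d c"
      have oU: "open ?U" using open_overlap d cA by blast
      \<comment> \<open>The differential acts on the constant vector \<open>v c\<close>, so a fixed
        direction is enough for smoothness in the base point.\<close>
      have sm: "smooth_on ?U (\<lambda>x. frechet_derivative (transition c d) (at (transition d c x)) (v c))"
        by (rule smooth_on_compose[where T = "overlap c d"])
          (use d cA oU transition_in_overlap in \<open>auto intro!: smooth_intros transition_smooth\<close>)
      have sm2: "smooth_on ?U (\<lambda>x. bump (transition d c x))"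
        by (rule smooth_on_compose[OF bump_smooth[OF open_UNIV] transition_smooth[OF d cA(1)] oU]) auto
      have "smooth_on ?U (\<lambda>x. X (chart_inv d x) d)"
      proof (rule smooth_on_cong[OF oU smooth_on_scaleR[OF sm2 sm oU]])
        fix y assume "y \<in> ?U"
        then have y: "y \<in> chart_image d" "chart_inv d y \<in> chart_dom c"
          using d cA by (auto simp: overlap_iff)
        then show "bump (transition d c y) *\<^sub>R frechet_derivative (transition c d) (at (transition d c y)) (v c)
          = X (chart_inv d y) d"
          using d by (simp add: X_def coord_tangent_def charts_at_chart_inv) (simp add: transition_def)
      qed
      then show ?thesis using oU True d cA x by (auto simp: overlap_iff)
    next
      case False
      let ?U = "{x \<in> chart_image d. chart_inv d x \<in> - K}"
      have oU: "open ?U" using open_preimage_chart_inv[OF d \<open>open (- K)\<close>] .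
      have "K \<subseteq> chart_dom c" using r cA by (auto simp: K_def chart_inv_in_dom)
      then have "x \<in> ?U" using False x by auto
      moreover have "smooth_on ?U (\<lambda>x. X (chart_inv d x) d)"
        by (rule smooth_on_cong[OF oU smooth_on_const[of _ 0]]) (simp add: X0)
      ultimately show ?thesis using oU by blast
    qed
  qed
  ultimately have "vector_field A X" by (simp add: vector_field_def)
  moreover have "X p = v"
    using cA bump_x0 coord_tangent_coord[OF v c] by (simp add: X_def x0_def)
  ultimately show ?thesis by blast
qed

end

section \<open>Christoffel symbols and the Levi-Civita connection\<close>

context riemannian_manifold
begin

abbreviation G where "G \<equiv> coord_metric A g"

text \<open>The direction of differentiation is the last, unwritten argument.\<close>

definition DG where "DG c x u w = frechet_derivative (\<lambda>x. G c x u w) (at x)"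

lemma metric_add_right:
  "v \<in> tangent_space A p \<Longrightarrow> w \<in> tangent_space A p \<Longrightarrow> w' \<in> tangent_space A p \<Longrightarrow>
    g p v (w + w') = g p v w + g p v w'"
  using metric_linear[of v p] unfolding linear_on_subspace_def
  by (metis scaleR_one)

lemma metric_scaleR_right:
  "v \<in> tangent_space A p \<Longrightarrow> w \<in> tangent_space A p \<Longrightarrow> g p v (r *\<^sub>R w) = r * g p v w"
  using metric_linear[of v p] unfolding linear_on_subspace_def
  by (metis add_cancel_left_right real_scaleR_def scaleR_zero_left)

lemma coord_metric_metric:
  assumes "v \<in> tangent_space A p" "w \<in> tangent_space A p" "c \<in> charts_at A p"
  shows "g p v w = G c (chart_map c p) (v c) (w c)"
  using assms by (simp add: coord_metric_def Let_def chart_inv_map coord_tangent_coord charts_at_iff[of c p])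

lemma coord_metric_sym:
  "c \<in> A \<Longrightarrow> x \<in> chart_image c \<Longrightarrow> G c x u w = G c x w u"
  by (simp add: coord_metric_def Let_def charts_at_chart_inv coord_tangent_in_tangent_space metric_sym)

lemma coord_metric_linear_right:
  assumes "c \<in> A" "x \<in> chart_image c"
  shows "linear (\<lambda>w. G c x u w)"
  using charts_at_chart_inv[OF assms]
  by (intro linearI) (simp_all add: coord_metric_def Let_def coord_tangent_add coord_tangent_scaleR
      coord_tangent_in_tangent_space metric_add_right metric_scaleR_right)

lemma coord_metric_linear_left:
  assumes "c \<in> A" "x \<in> chart_image c"
  shows "linear (\<lambda>u. G c x u w)"
  using coord_metric_linear_right[OF assms, of w] coord_metric_sym[OF assms] by simp

lemma coord_metric_pos:
  assumes "c \<in> A" "x \<in> chart_image c" "u \<noteq> 0"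
  shows "G c x u u > 0"
proof -
  have c: "c \<in> charts_at A (chart_inv c x)" using assms charts_at_chart_inv by blast
  have "coord_tangent A c (chart_inv c x) u \<noteq> 0"
    using coord_tangent_same[OF c, of u] assms(3) by auto
  then show ?thesis
    by (simp add: coord_metric_def Let_def metric_pos coord_tangent_in_tangent_space[OF c])
qed

text \<open>Nondegeneracy follows from positivity, tested on \<open>u - w\<close>.\<close>

lemma coord_metric_cancel:
  assumes "c \<in> A" "x \<in> chart_image c" "\<And>z. G c x u z = G c x w z"
  shows "u = w"
proof (rule ccontr)
  assume "u \<noteq> w"
  then have "G c x (u - w) (u - w) > 0" using coord_metric_pos[OF assms(1,2)] by simp
  moreover have "G c x (u - w) (u - w) = 0"
    using assms(3) by (simp add: linear_diff[OF coord_metric_linear_left[OF assms(1,2)]])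
  ultimately show False by simp
qed

lemma coord_metric_has_derivative:
  assumes "c \<in> A" "x \<in> chart_image c"
  shows "((\<lambda>x. G c x u w) has_derivative DG c x u w) (at x)"
  unfolding DG_def using metric_smooth[OF assms(1)] assms(2) by (rule smooth_on_has_derivative)

lemma DG_eqI:
  assumes "c \<in> A" "x \<in> chart_image c" "(h has_derivative h') (at x)"
    and "\<And>y. y \<in> chart_image c \<Longrightarrow> h y = G c y u w"
  shows "DG c x u w = h'"
proof -
  have "((\<lambda>x. G c x u w) has_derivative h') (at x)"
    by (rule has_derivative_transform_within_open[OF assms(3) open_chart_image]) (use assms in auto)
  then show ?thesis unfolding DG_def by (metis frechet_derivative_at)
qed

lemma DG_linear_direction: "c \<in> A \<Longrightarrow> x \<in> chart_image c \<Longrightarrow> linear (DG c x u w)"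
  using coord_metric_has_derivative has_derivative_linear by blast

lemma DG_sym:
  assumes "c \<in> A" "x \<in> chart_image c"
  shows "DG c x u w = DG c x w u"
  by (rule DG_eqI[OF assms coord_metric_has_derivative[OF assms]]) (rule coord_metric_sym[OF assms(1)])

lemma DG_linear_right:
  assumes "c \<in> A" "x \<in> chart_image c"
  shows "linear (\<lambda>w. DG c x u w z)"
proof (rule linearI)
  fix w w' r
  note d = coord_metric_has_derivative[OF assms]
  have "DG c x u (w + w') = (\<lambda>z. DG c x u w z + DG c x u w' z)"
    by (rule DG_eqI[OF assms has_derivative_add[OF d d]])
      (simp add: linear_add[OF coord_metric_linear_right[OF assms(1)]])
  then show "DG c x u (w + w') z = DG c x u w z + DG c x u w' z" by simp
  have "DG c x u (r *\<^sub>R w) = (\<lambda>z. r *\<^sub>R DG c x u w z)"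
    by (rule DG_eqI[OF assms has_derivative_scaleR_right[OF d]])
      (simp add: linear_scale[OF coord_metric_linear_right[OF assms(1)]])
  then show "DG c x u (r *\<^sub>R w) z = r *\<^sub>R DG c x u w z" by simp
qed

lemma DG_linear_left:
  assumes "c \<in> A" "x \<in> chart_image c"
  shows "linear (\<lambda>u. DG c x u w z)"
  unfolding DG_sym[OF assms, of _ w] by (rule DG_linear_right[OF assms])

section \<open>Coordinate expansion and product rule for the metric\<close>

lemma coord_metric_expand:
  assumes "c \<in> A" "x \<in> chart_image c"
  shows "G c x u w = (\<Sum>i\<in>Basis. \<Sum>j\<in>Basis. (u \<bullet> i) * (w \<bullet> j) * G c x i j)"
proof -
  have "G c x u w = (\<Sum>i\<in>Basis. (u \<bullet> i) * G c x i w)"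
    by (rule linear_basis_sum[OF coord_metric_linear_left[OF assms], unfolded real_scaleR_def])
  also have "\<dots> = (\<Sum>i\<in>Basis. (u \<bullet> i) * (\<Sum>j\<in>Basis. (w \<bullet> j) * G c x i j))"
    by (intro sum.cong refl arg_cong2[where f = "(*)"]
        linear_basis_sum[OF coord_metric_linear_right[OF assms], unfolded real_scaleR_def])
  finally show ?thesis by (simp add: sum_distrib_left mult.assoc)
qed

lemma DG_expand:
  assumes "c \<in> A" "x \<in> chart_image c"
  shows "DG c x u w z = (\<Sum>i\<in>Basis. \<Sum>j\<in>Basis. (u \<bullet> i) * (w \<bullet> j) * DG c x i j z)"
proof -
  have "DG c x u w z = (\<Sum>i\<in>Basis. (u \<bullet> i) * DG c x i w z)"
    by (rule linear_basis_sum[OF DG_linear_left[OF assms], unfolded real_scaleR_def])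
  also have "\<dots> = (\<Sum>i\<in>Basis. (u \<bullet> i) * (\<Sum>j\<in>Basis. (w \<bullet> j) * DG c x i j z))"
    by (intro sum.cong refl arg_cong2[where f = "(*)"]
        linear_basis_sum[OF DG_linear_right[OF assms], unfolded real_scaleR_def])
  finally show ?thesis by (simp add: sum_distrib_left mult.assoc)
qed

text \<open>The base point and both arguments depend on \<open>t\<close>. After expansion over
  \<open>Basis\<close>, valid near \<open>t\<close> where the curve stays in the chart, this is the
  ordinary product rule for scalar coefficients.\<close>

lemma coord_metric_product_rule:
  assumes "c \<in> A" "y t \<in> chart_image c"
    and "(y has_derivative y') (at t)" "(a has_derivative a') (at t)" "(b has_derivative b') (at t)"
  shows "((\<lambda>t. G c (y t) (a t) (b t)) has_derivative
    (\<lambda>h. DG c (y t) (a t) (b t) (y' h) + G c (y t) (a' h) (b t) + G c (y t) (a t) (b' h))) (at t)"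
proof -
  have ev: "\<forall>\<^sub>F s in at t. y s \<in> chart_image c"
    using has_derivative_continuous[OF assms(3)] open_chart_image[OF assms(1)] assms(2)
    by (simp add: continuous_at topological_tendstoD)
  have G: "((\<lambda>t. G c (y t) i j) has_derivative (\<lambda>h. DG c (y t) i j (y' h))) (at t)" for i j
    using diff_chain_at[OF assms(3) coord_metric_has_derivative[OF assms(1,2)]] by (simp add: o_def)
  have "((\<lambda>t. \<Sum>i\<in>Basis. \<Sum>j\<in>Basis. (a t \<bullet> i) * (b t \<bullet> j) * G c (y t) i j) has_derivative
    (\<lambda>h. \<Sum>i\<in>Basis. \<Sum>j\<in>Basis. (a t \<bullet> i) * (b t \<bullet> j) * DG c (y t) i j (y' h)
      + ((a t \<bullet> i) * (b' h \<bullet> j) + (a' h \<bullet> i) * (b t \<bullet> j)) * G c (y t) i j)) (at t)"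
    by (intro has_derivative_sum has_derivative_mult G has_derivative_inner_left assms)
  then have "((\<lambda>t. G c (y t) (a t) (b t)) has_derivative
    (\<lambda>h. \<Sum>i\<in>Basis. \<Sum>j\<in>Basis. (a t \<bullet> i) * (b t \<bullet> j) * DG c (y t) i j (y' h)
      + ((a t \<bullet> i) * (b' h \<bullet> j) + (a' h \<bullet> i) * (b t \<bullet> j)) * G c (y t) i j)) (at t)"
    by (rule has_derivative_transform_eventually)
      (auto intro: eventually_mono[OF ev] coord_metric_expand[OF assms(1), symmetric] assms(2))
  moreover have "(\<Sum>i\<in>Basis. \<Sum>j\<in>Basis. (a t \<bullet> i) * (b t \<bullet> j) * DG c (y t) i j (y' h)
      + ((a t \<bullet> i) * (b' h \<bullet> j) + (a' h \<bullet> i) * (b t \<bullet> j)) * G c (y t) i j) =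
     DG c (y t) (a t) (b t) (y' h) + G c (y t) (a' h) (b t) + G c (y t) (a t) (b' h)" for h
    unfolding DG_expand[OF assms(1,2), of "a t" "b t"] coord_metric_expand[OF assms(1,2), of "a' h" "b t"]
      coord_metric_expand[OF assms(1,2), of "a t" "b' h"] sum.distrib[symmetric]
    by (intro sum.cong refl) (simp add: algebra_simps)
  ultimately show ?thesis by simp
qed

section \<open>Christoffel symbols and their transformation law\<close>

text \<open>Justifies the definite description in \<open>christoffel\<close>: lowering an index with
  a positive definite metric is injective, hence bijective in finite dimension.\<close>

lemma christoffel_eq:
  assumes "c \<in> A" "x \<in> chart_image c"
  shows "G c x (christoffel A g c x u w) z = (DG c x w z u + DG c x u z w - DG c x u w z) / 2"
proof -
  let ?L = "\<lambda>z. (DG c x w z u + DG c x u z w - DG c x u w z) / 2"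
  have L: "linear ?L"
    by (intro linearI) (simp_all add: linear_add[OF DG_linear_right[OF assms]]
        linear_scale[OF DG_linear_right[OF assms]] linear_add[OF DG_linear_direction[OF assms]]
        linear_scale[OF DG_linear_direction[OF assms]] field_simps)
  \<comment> \<open>\<open>\<Phi> y\<close> lists the values of the functional
    \<open>G c x y\<close> on the basis, so that the dimension argument concerns an endomorphism of
    the model space.\<close>
  define \<Phi> where "\<Phi> y = (\<Sum>b\<in>Basis. G c x y b *\<^sub>R b)" for y
  have lin: "linear \<Phi>"
    unfolding \<Phi>_def by (intro linearI) (simp_all add: linear_add[OF coord_metric_linear_left[OF assms]]
        linear_scale[OF coord_metric_linear_left[OF assms]] scaleR_add_left sum.distrib scaleR_sum_right)
  have comp: "\<Phi> y \<bullet> b = G c x y b" if "b \<in> Basis" for y b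
    using that by (simp add: \<Phi>_def)
  have ext: "G c x y = h" if "linear h" "\<And>b. b \<in> Basis \<Longrightarrow> G c x y b = h b" for y h
    by (rule linear_eq_stdbasis[OF coord_metric_linear_right[OF assms] that])
  have "inj \<Phi>"
  proof (rule injI)
    fix y y' assume "\<Phi> y = \<Phi> y'"
    then have "G c x y b = G c x y' b" if "b \<in> Basis" for b using comp that by metis
    then have "G c x y = G c x y'" by (intro ext coord_metric_linear_right[OF assms])
    then show "y = y'" by (intro coord_metric_cancel[OF assms]) simp
  qed
  then have "surj \<Phi>" using linear_injective_imp_surjective[OF lin] by blast
  then obtain y where "(\<Sum>b\<in>Basis. ?L b *\<^sub>R b) = \<Phi> y" by (rule surjE)
  then have "\<Phi> y = (\<Sum>b\<in>Basis. ?L b *\<^sub>R b)" by (rule sym)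
  then have "G c x y b = ?L b" if "b \<in> Basis" for b
    using comp[OF that, of y] that by simp
  then have "G c x y = ?L" by (rule ext[OF L])
  then have y: "G c x y z = ?L z" for z by (rule fun_cong)
  have "\<forall>z. G c x (christoffel A g c x u w) z = ?L z"
    unfolding christoffel_def DG_def[symmetric]
  proof (rule theI[of _ y])
    show "\<forall>z. G c x y z = ?L z" using y by blast
    fix y' assume "\<forall>z. G c x y' z = ?L z"
    then show "y' = y" by (intro coord_metric_cancel[OF assms]) (simp only: y)
  qed
  then show ?thesis by blast
qed

lemma christoffel_eqI:
  assumes "c \<in> A" "x \<in> chart_image c"
    and "\<And>z. 2 * G c x y z = DG c x w z u + DG c x u z w - DG c x u w z"
  shows "christoffel A g c x u w = y"
  using assms(3) by (intro coord_metric_cancel[OF assms(1,2)]) (simp add: christoffel_eq[OF assms(1,2)] field_simps)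

lemma christoffel_linear:
  assumes "c \<in> A" "x \<in> chart_image c"
  shows "linear (christoffel A g c x u)"
proof (rule linearI)
  note simps = christoffel_eq[OF assms] linear_add[OF coord_metric_linear_left[OF assms]]
    linear_scale[OF coord_metric_linear_left[OF assms]]
    linear_add[OF DG_linear_right[OF assms]] linear_add[OF DG_linear_left[OF assms]]
    linear_add[OF DG_linear_direction[OF assms]]
    linear_scale[OF DG_linear_right[OF assms]] linear_scale[OF DG_linear_left[OF assms]]
    linear_scale[OF DG_linear_direction[OF assms]]
  show "christoffel A g c x u (w + w') = christoffel A g c x u w + christoffel A g c x u w'" for w w'
    by (rule christoffel_eqI[OF assms]) (simp add: simps field_simps)
  show "christoffel A g c x u (r *\<^sub>R w) = r *\<^sub>R christoffel A g c x u w" for r w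
    by (rule christoffel_eqI[OF assms]) (simp add: simps field_simps)
qed

text \<open>A coordinate vector in \<open>c\<close> and its image under the differential describe
  the same tangent vector.\<close>

lemma coord_metric_transition:
  assumes "c \<in> A" "d \<in> A" "x \<in> overlap c d"
  shows "G c x u w = G d (transition c d x) (frechet_derivative (transition c d) (at x) u)
    (frechet_derivative (transition c d) (at x) w)"
proof -
  obtain p where p: "p \<in> chart_dom c" "p \<in> chart_dom d" "x = chart_map c p"
    using assms by (auto simp: overlap_def)
  then have "c \<in> charts_at A p" "d \<in> charts_at A p" using assms by (auto simp: charts_at_iff)
  then show ?thesis
    using p assms by (simp add: coord_metric_def Let_def transition_map chart_inv_map coord_tangent_transition)
qed

text \<open>The inhomogeneous transformation law. Differentiating the relation between the metric
  coefficients in \<open>c\<close> and \<open>d\<close> adds second derivatives of the transition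
  map; in the combination of three terms their symmetry cancels all but twice the pairing of
  \<open>\<phi>'' u w\<close> with \<open>z'\<close>.\<close>

lemma christoffel_transition:
  assumes c: "c \<in> charts_at A p" and d: "d \<in> charts_at A p"
  defines "x \<equiv> chart_map c p" and "\<phi>' \<equiv> \<lambda>x. frechet_derivative (transition c d) (at x)"
  shows "\<phi>' x (christoffel A g c x u w) =
    christoffel A g d (chart_map d p) (\<phi>' x u) (\<phi>' x w) + frechet_derivative (\<lambda>x. \<phi>' x w) (at x) u"
proof -
  have A: "c \<in> A" "d \<in> A" "x \<in> chart_image c" "x \<in> overlap c d" "transition c d x = chart_map d p"
    "chart_map d p \<in> chart_image d"
    using c d by (auto simp: charts_at_iff x_def chart_map_in_image overlap_def transition_map)
  define \<phi>'' where "\<phi>'' u w = frechet_derivative (\<lambda>x. \<phi>' x w) (at x) u" for u w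
  have sm: "smooth_on (overlap c d) (\<lambda>x. \<phi>' x w)" for w
    unfolding \<phi>'_def using transition_smooth[OF A(1,2)] by (rule smooth_on_derivative)
  have d2: "((\<lambda>x. \<phi>' x w) has_derivative (\<lambda>u. \<phi>'' u w)) (at x)" for w
    unfolding \<phi>''_def by (rule smooth_on_has_derivative[OF sm A(4)])
  have sym: "\<phi>'' u w = \<phi>'' w u" for u w
    unfolding \<phi>''_def \<phi>'_def
    by (rule second_derivative_symmetric[OF open_overlap[OF A(1,2)] A(4) transition_smooth[OF A(1,2)]])
  have d1: "(transition c d has_derivative \<phi>' x) (at x)"
    unfolding \<phi>'_def x_def by (rule transition_has_derivative[OF c d])
  let ?y = "chart_map d p" and ?G = "G d (chart_map d p)" and ?D = "DG d (chart_map d p)"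
  have DG: "DG c x a b z = ?D (\<phi>' x a) (\<phi>' x b) (\<phi>' x z) + ?G (\<phi>'' z a) (\<phi>' x b) + ?G (\<phi>' x a) (\<phi>'' z b)"
    for a b z
  proof -
    have "((\<lambda>x. G d (transition c d x) (\<phi>' x a) (\<phi>' x b)) has_derivative
      (\<lambda>z. ?D (\<phi>' x a) (\<phi>' x b) (\<phi>' x z) + ?G (\<phi>'' z a) (\<phi>' x b) + ?G (\<phi>' x a) (\<phi>'' z b))) (at x)"
      using coord_metric_product_rule[OF A(2) _ d1 d2 d2] A by simp
    then have "((\<lambda>x. G c x a b) has_derivative
      (\<lambda>z. ?D (\<phi>' x a) (\<phi>' x b) (\<phi>' x z) + ?G (\<phi>'' z a) (\<phi>' x b) + ?G (\<phi>' x a) (\<phi>'' z b))) (at x)"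
      by (rule has_derivative_transform_within_open[OF _ open_overlap[OF A(1,2)] A(4)])
        (simp add: coord_metric_transition[OF A(1,2)] \<phi>'_def)
    from fun_cong[OF frechet_derivative_at[OF this, symmetric]] show ?thesis unfolding DG_def .
  qed
  have "christoffel A g d ?y (\<phi>' x u) (\<phi>' x w) = \<phi>' x (christoffel A g c x u w) - \<phi>'' u w"
  proof (rule christoffel_eqI[OF A(2,6)])
    fix z'
    \<comment> \<open>Every test vector is in the image of \<open>\<phi>' x\<close>; the
      differential of the reverse transition supplies the preimage.\<close>
    define z where "z = frechet_derivative (transition d c) (at ?y) z'"
    have z': "z' = \<phi>' x z"
      using transition_derivative_cocycle[OF d c d, of z'] transition_derivative_self[OF d]
      by (simp add: z_def \<phi>'_def x_def)
    have "2 * ?G (\<phi>' x (christoffel A g c x u w)) z' = 2 * G c x (christoffel A g c x u w) z"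
      using coord_metric_transition[OF A(1,2,4), of _ z] A(5) by (simp add: z' \<phi>'_def)
    also have "\<dots> = DG c x w z u + DG c x u z w - DG c x u w z"
      by (simp add: christoffel_eq[OF A(1,3)])
    also have "\<dots> = ?D (\<phi>' x w) z' (\<phi>' x u) + ?D (\<phi>' x u) z' (\<phi>' x w) - ?D (\<phi>' x u) (\<phi>' x w) z'
       + 2 * ?G (\<phi>'' u w) z'"
      unfolding DG z' using sym[of z u] sym[of z w] sym[of u w]
        coord_metric_sym[OF A(2,6)] by simp
    finally show "2 * ?G (\<phi>' x (christoffel A g c x u w) - \<phi>'' u w) z' =
        ?D (\<phi>' x w) z' (\<phi>' x u) + ?D (\<phi>' x u) z' (\<phi>' x w) - ?D (\<phi>' x u) (\<phi>' x w) z'"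
      by (simp add: linear_diff[OF coord_metric_linear_left[OF A(2,6)]])
  qed
  then show ?thesis by (simp add: \<phi>''_def)
qed

section \<open>The Levi-Civita derivative of vector fields\<close>

lemma vector_field_in_tangent_space: "vector_field A X \<Longrightarrow> X p \<in> tangent_space A p"
  by (simp add: vector_field_def)

text \<open>Under a change of charts the derivative of the components of \<open>Y\<close> acquires a
  second derivative of the transition map, and the Christoffel term acquires its negative; the sum
  transforms like a tangent vector.\<close>

lemma levi_civita_in_tangent_space:
  assumes X: "vector_field A X" and Y: "vector_field A Y"
  shows "levi_civita A g X Y p \<in> tangent_space A p"
proof (rule tangent_spaceI)
  fix c d assume c: "c \<in> charts_at A p" and d: "d \<in> charts_at A p"
  define x where "x = chart_map c p"
  define \<phi>' where "\<phi>' x = frechet_derivative (transition c d) (at x)" for x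
  let ?Yc = "\<lambda>x. Y (chart_inv c x) c" and ?Yd = "\<lambda>x. Y (chart_inv d x) d"
  have A: "c \<in> A" "d \<in> A" "x \<in> chart_image c" "x \<in> overlap c d" "transition c d x = chart_map d p"
    "chart_map d p \<in> chart_image d" "p \<in> chart_dom c" "p \<in> chart_dom d"
    using c d by (auto simp: charts_at_iff x_def chart_map_in_image overlap_def transition_map)
  have Yc: "(?Yc has_derivative coord_deriv c Y p) (at x)" unfolding coord_deriv_def x_def[symmetric]
    by (rule smooth_on_has_derivative[OF _ A(3)]) (use Y A in \<open>auto simp: vector_field_def\<close>)
  have Yd: "(?Yd has_derivative coord_deriv d Y p) (at (transition c d x))" unfolding coord_deriv_def A(5)
    by (rule smooth_on_has_derivative[OF _ A(6)]) (use Y A in \<open>auto simp: vector_field_def\<close>)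
  have d1: "(transition c d has_derivative \<phi>' x) (at x)"
    unfolding \<phi>'_def x_def by (rule transition_has_derivative[OF c d])
  have sm: "smooth_on (overlap c d) (\<lambda>x. \<phi>' x w)" for w
    unfolding \<phi>'_def using transition_smooth[OF A(1,2)] by (rule smooth_on_derivative)
  \<comment> \<open>The differential is applied to the moving vector \<open>?Yc y\<close>; in this
    form the product rule can differentiate it.\<close>
  have YcYd: "?Yd (transition c d y) = (\<Sum>b\<in>Basis. (?Yc y \<bullet> b) *\<^sub>R \<phi>' y b)" if y: "y \<in> overlap c d" for y
  proof -
    obtain q where q: "q \<in> chart_dom c" "q \<in> chart_dom d" "y = chart_map c q"
      using y by (auto simp: overlap_def)
    have cd: "c \<in> charts_at A q" "d \<in> charts_at A q" using q A by (auto simp: charts_at_iff)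
    have "?Yd (transition c d y) = \<phi>' y (?Yc y)"
      using q A tangent_space_transition[OF vector_field_in_tangent_space[OF Y] cd]
      by (simp add: transition_map chart_inv_map \<phi>'_def)
    then show ?thesis
      unfolding \<phi>'_def q(3) by (simp only: linear_basis_sum[OF transition_linear[OF cd], symmetric])
  qed
  have "((\<lambda>x. \<Sum>b\<in>Basis. (?Yc x \<bullet> b) *\<^sub>R \<phi>' x b) has_derivative
    (\<lambda>u. \<Sum>b\<in>Basis. (?Yc x \<bullet> b) *\<^sub>R frechet_derivative (\<lambda>x. \<phi>' x b) (at x) u
       + (coord_deriv c Y p u \<bullet> b) *\<^sub>R \<phi>' x b)) (at x)"
    by (intro has_derivative_sum has_derivative_scaleR has_derivative_inner_left Yc
        smooth_on_has_derivative[OF sm A(4)])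
  then have "((\<lambda>x. ?Yd (transition c d x)) has_derivative
    (\<lambda>u. \<Sum>b\<in>Basis. (?Yc x \<bullet> b) *\<^sub>R frechet_derivative (\<lambda>x. \<phi>' x b) (at x) u
       + (coord_deriv c Y p u \<bullet> b) *\<^sub>R \<phi>' x b)) (at x)"
    by (rule has_derivative_transform_within_open[OF _ open_overlap[OF A(1,2)] A(4)]) (simp add: YcYd)
  moreover have "((\<lambda>x. ?Yd (transition c d x)) has_derivative (\<lambda>u. coord_deriv d Y p (\<phi>' x u))) (at x)"
    using diff_chain_at[OF d1 Yd] by (simp add: o_def)
  ultimately have "(\<lambda>u. coord_deriv d Y p (\<phi>' x u)) = (\<lambda>u. \<Sum>b\<in>Basis. (?Yc x \<bullet> b) *\<^sub>R frechet_derivative (\<lambda>x. \<phi>' x b) (at x) u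
       + (coord_deriv c Y p u \<bullet> b) *\<^sub>R \<phi>' x b)"
    by (rule has_derivative_unique[rotated])
  from fun_cong[OF this] have eq: "coord_deriv d Y p (\<phi>' x u) = (\<Sum>b\<in>Basis. (?Yc x \<bullet> b) *\<^sub>R frechet_derivative (\<lambda>x. \<phi>' x b) (at x) u
       + (coord_deriv c Y p u \<bullet> b) *\<^sub>R \<phi>' x b)" for u
    .
  \<comment> \<open>Linearity in \<open>w\<close> comes from linearity in the direction of
    differentiation, by symmetry of the second derivative.\<close>
  have lin2: "linear (\<lambda>w. frechet_derivative (\<lambda>x. \<phi>' x w) (at x) u)" for u
    using smooth_on_linear[OF sm A(4)]
      second_derivative_symmetric[OF open_overlap[OF A(1,2)] A(4) transition_smooth[OF A(1,2)], of _ u]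
    by (simp add: \<phi>'_def)
  have lin1: "linear (\<phi>' x)" unfolding \<phi>'_def x_def by (rule transition_linear[OF c d])
  have "coord_deriv d Y p (\<phi>' x u) = frechet_derivative (\<lambda>x. \<phi>' x (Y p c)) (at x) u + \<phi>' x (coord_deriv c Y p u)" for u
  proof -
    have "?Yc x = Y p c" using A by (simp add: x_def chart_inv_map)
    moreover have "(\<Sum>b\<in>Basis. (Y p c \<bullet> b) *\<^sub>R frechet_derivative (\<lambda>x. \<phi>' x b) (at x) u) =
        frechet_derivative (\<lambda>x. \<phi>' x (Y p c)) (at x) u"
      by (rule linear_basis_sum[OF lin2, symmetric])
    moreover have "(\<Sum>b\<in>Basis. (coord_deriv c Y p u \<bullet> b) *\<^sub>R \<phi>' x b) = \<phi>' x (coord_deriv c Y p u)"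
      by (rule linear_basis_sum[OF lin1, symmetric])
    ultimately show ?thesis by (simp only: eq sum.distrib)
  qed
  moreover have "X p d = \<phi>' x (X p c)" "Y p d = \<phi>' x (Y p c)"
    using tangent_space_transition[OF vector_field_in_tangent_space c d] X Y by (auto simp: \<phi>'_def x_def)
  ultimately show "levi_civita A g X Y p d =
      frechet_derivative (transition c d) (at (chart_map c p)) (levi_civita A g X Y p c)"
    using christoffel_transition[OF c d, of "X p c" "Y p c"] c d linear_add[OF lin1]
    by (simp add: levi_civita_def \<phi>'_def x_def)
qed (simp add: levi_civita_def)

text \<open>Serves to drop the derivative of \<open>f (\<xi> j)\<close>, which is the zero field,
  from the covariant derivative of \<open>f\<close>.\<close>

lemma levi_civita_zero: "levi_civita A g X (\<lambda>q. 0) p = 0"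
  by (auto simp: levi_civita_def coord_deriv_def fun_eq_iff charts_at_iff
      linear_0[OF christoffel_linear[OF _ chart_map_in_image]])

end


lemma smooth_on_has_vector_derivative:
  assumes "smooth_on S f" "t \<in> S"
  shows "(f has_vector_derivative vector_derivative f (at t)) (at t)"
  using smooth_on_differentiable[OF assms] by (simp add: vector_derivative_works[symmetric])

lemma smooth_on_vector_derivative:
  assumes "smooth_on S f" "open S"
  shows "smooth_on S (\<lambda>t. vector_derivative f (at t))"
proof (rule smooth_on_cong[OF assms(2) smooth_on_derivative[OF assms(1), of 1]])
  fix t assume "t \<in> S"
  then show "frechet_derivative f (at t) 1 = vector_derivative f (at t)"
    using smooth_on_differentiable[OF assms(1)] by (simp add: frechet_derivative_eq_vector_derivative)
qed

section \<open>Covariant derivatives along curves\<close>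

context riemannian_manifold
begin

section \<open>Bilinearity of the metric on tangent spaces\<close>

lemma metric_scaleR_left:
  "v \<in> tangent_space A p \<Longrightarrow> w \<in> tangent_space A p \<Longrightarrow> g p (r *\<^sub>R v) w = r * g p v w"
  by (simp add: metric_sym[of _ p w] metric_scaleR_right tangent_space_scaleR)

lemma metric_add_left:
  "v \<in> tangent_space A p \<Longrightarrow> v' \<in> tangent_space A p \<Longrightarrow> w \<in> tangent_space A p \<Longrightarrow>
    g p (v + v') w = g p v w + g p v' w"
  by (simp add: metric_sym[of _ p w] metric_add_right tangent_space_add)

lemma metric_zero_right: "v \<in> tangent_space A p \<Longrightarrow> g p v 0 = 0"
  using metric_scaleR_right[of v p 0 0] tangent_space_zero by simp

lemma metric_zero_left: "v \<in> tangent_space A p \<Longrightarrow> g p 0 v = 0"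
  using metric_scaleR_left[of 0 p v 0] tangent_space_zero by simp

lemma metric_sum_right:
  "v \<in> tangent_space A p \<Longrightarrow> (\<And>i. i \<in> J \<Longrightarrow> w i \<in> tangent_space A p) \<Longrightarrow>
    g p v (\<Sum>i\<in>J. w i) = (\<Sum>i\<in>J. g p v (w i))"
  by (induction J rule: infinite_finite_induct)
    (auto simp: metric_zero_right metric_add_right tangent_space_sum)

lemma metric_sum_left:
  "w \<in> tangent_space A p \<Longrightarrow> (\<And>i. i \<in> J \<Longrightarrow> v i \<in> tangent_space A p) \<Longrightarrow>
    g p (\<Sum>i\<in>J. v i) w = (\<Sum>i\<in>J. g p (v i) w)"
  by (induction J rule: infinite_finite_induct)
    (auto simp: metric_zero_left metric_add_left tangent_space_sum)

section \<open>Vector fields along a curve and their derivatives\<close>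

lemma open_curve_chart_dom:
  assumes "open I" "smooth_curve A I \<gamma>" "c \<in> A"
  shows "open {t \<in> I. \<gamma> t \<in> chart_dom c}"
proof -
  have "{t \<in> I. \<gamma> t \<in> chart_dom c} = \<gamma> -` chart_dom c \<inter> I" by auto
  then show ?thesis
    using assms continuous_on_open_vimage[OF assms(1), of \<gamma>] open_chart_dom[OF assms(3)]
    by (simp add: smooth_curve_def)
qed

lemma curve_has_velocity:
  assumes "smooth_curve A I \<gamma>" "t \<in> I" "c \<in> charts_at A (\<gamma> t)"
  shows "(chart_map c \<circ> \<gamma> has_vector_derivative velocity A \<gamma> t c) (at t)"
proof -
  have "smooth_on {t \<in> I. \<gamma> t \<in> chart_dom c} (chart_map c \<circ> \<gamma>)"
    using assms by (auto simp: smooth_curve_def charts_at_iff)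
  from smooth_on_has_vector_derivative[OF this, of t] show ?thesis
    using assms by (simp add: velocity_def charts_at_iff)
qed

lemma vector_field_along_in_tangent_space:
  "vector_field_along A I \<gamma> V \<Longrightarrow> t \<in> I \<Longrightarrow> V t \<in> tangent_space A (\<gamma> t)"
  by (simp add: vector_field_along_def)

lemma vector_field_along_has_derivative:
  assumes "vector_field_along A I \<gamma> V" "t \<in> I" "c \<in> charts_at A (\<gamma> t)"
  shows "((\<lambda>t. V t c) has_vector_derivative vector_derivative (\<lambda>t. V t c) (at t)) (at t)"
  by (rule smooth_on_has_vector_derivative[where S = "{t \<in> I. \<gamma> t \<in> chart_dom c}"])
    (use assms in \<open>auto simp: vector_field_along_def charts_at_iff\<close>)

text \<open>The derivative at \<open>t\<close> sees its field only near \<open>t\<close>, so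
  identities known on the open set \<open>I\<close>, such as the Frenet equations, can be
  differentiated there.\<close>

lemma cov_deriv_along_cong:
  assumes "open I" "t \<in> I" "\<And>t. t \<in> I \<Longrightarrow> V t = W t"
  shows "cov_deriv_along A g \<gamma> V t = cov_deriv_along A g \<gamma> W t"
proof
  fix c
  have "\<forall>\<^sub>F t in nhds t. t \<in> I" using assms by (simp add: eventually_nhds_in_open)
  then have "\<forall>\<^sub>F t in nhds t. V t c = W t c" by (rule eventually_mono) (simp add: assms(3))
  then have "vector_derivative (\<lambda>t. V t c) (at t) = vector_derivative (\<lambda>t. W t c) (at t)"
    by (intro vector_derivative_cong_eq refl) auto
  then show "cov_deriv_along A g \<gamma> V t c = cov_deriv_along A g \<gamma> W t c"
    by (simp add: cov_deriv_along_def assms(2,3))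
qed

lemma cov_deriv_along_eqI:
  assumes "\<And>c. c \<in> charts_at A (\<gamma> t) \<Longrightarrow> \<exists>D. ((\<lambda>t. V t c) has_vector_derivative D) (at t) \<and>
      v c = D + christoffel A g c (chart_map c (\<gamma> t)) (velocity A \<gamma> t c) (V t c)"
    and "\<And>c. c \<notin> charts_at A (\<gamma> t) \<Longrightarrow> v c = 0"
  shows "cov_deriv_along A g \<gamma> V t = v"
proof
  fix c
  show "cov_deriv_along A g \<gamma> V t c = v c"
    using assms(1)[of c] assms(2)[of c] vector_derivative_at
    by (cases "c \<in> charts_at A (\<gamma> t)") (auto simp: cov_deriv_along_def)
qed

lemma cov_deriv_along_coord:
  "c \<in> charts_at A (\<gamma> t) \<Longrightarrow> cov_deriv_along A g \<gamma> V t c =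
    vector_derivative (\<lambda>t. V t c) (at t) + christoffel A g c (chart_map c (\<gamma> t)) (velocity A \<gamma> t c) (V t c)"
  by (simp add: cov_deriv_along_def)

lemma cov_deriv_along_combination:
  assumes V: "vector_field_along A I \<gamma> V" and W: "vector_field_along A I \<gamma> W" and t: "t \<in> I"
    and h: "(h has_real_derivative h') (at t)" and k: "(k has_real_derivative k') (at t)"
  shows "cov_deriv_along A g \<gamma> (\<lambda>t. h t *\<^sub>R V t + k t *\<^sub>R W t) t =
    h' *\<^sub>R V t + h t *\<^sub>R cov_deriv_along A g \<gamma> V t + (k' *\<^sub>R W t + k t *\<^sub>R cov_deriv_along A g \<gamma> W t)"
proof (rule cov_deriv_along_eqI)
  fix c assume c: "c \<in> charts_at A (\<gamma> t)"
  then have lin: "linear (christoffel A g c (chart_map c (\<gamma> t)) (velocity A \<gamma> t c))"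
    by (intro christoffel_linear) (auto simp: charts_at_iff chart_map_in_image)
  have "((\<lambda>t. h t *\<^sub>R V t c + k t *\<^sub>R W t c) has_vector_derivative
    (h t *\<^sub>R vector_derivative (\<lambda>t. V t c) (at t) + h' *\<^sub>R V t c) +
    (k t *\<^sub>R vector_derivative (\<lambda>t. W t c) (at t) + k' *\<^sub>R W t c)) (at t)"
    by (intro has_vector_derivative_add has_vector_derivative_scaleR h k
        vector_field_along_has_derivative[OF V t c] vector_field_along_has_derivative[OF W t c])
  then show "\<exists>D. ((\<lambda>t. (h t *\<^sub>R V t + k t *\<^sub>R W t) c) has_vector_derivative D) (at t) \<and>
      (h' *\<^sub>R V t + h t *\<^sub>R cov_deriv_along A g \<gamma> V t + (k' *\<^sub>R W t + k t *\<^sub>R cov_deriv_along A g \<gamma> W t)) c =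
      D + christoffel A g c (chart_map c (\<gamma> t)) (velocity A \<gamma> t c) ((h t *\<^sub>R V t + k t *\<^sub>R W t) c)"
    by (intro exI conjI)
      (auto simp: cov_deriv_along_coord[where \<gamma> = \<gamma> and t = t, OF c] linear_add[OF lin] linear_scale[OF lin] algebra_simps)
next
  \<comment> \<open>A tangent vector is a function on all charts; at charts not around
    \<open>\<gamma> t\<close> both fields vanish by tangency.\<close>
  fix c assume c: "c \<notin> charts_at A (\<gamma> t)"
  then show "(h' *\<^sub>R V t + h t *\<^sub>R cov_deriv_along A g \<gamma> V t + (k' *\<^sub>R W t + k t *\<^sub>R cov_deriv_along A g \<gamma> W t)) c = 0"
    using tangent_space_0[OF vector_field_along_in_tangent_space[OF V t] c]
      tangent_space_0[OF vector_field_along_in_tangent_space[OF W t] c]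
    by (simp add: cov_deriv_along_def)
qed

lemma cov_deriv_along_scaleR:
  assumes V: "vector_field_along A I \<gamma> V" and t: "t \<in> I" and h: "(h has_real_derivative h') (at t)"
  shows "cov_deriv_along A g \<gamma> (\<lambda>t. h t *\<^sub>R V t) t = h' *\<^sub>R V t + h t *\<^sub>R cov_deriv_along A g \<gamma> V t"
  using cov_deriv_along_combination[OF V V t h DERIV_const[of 0]] by simp

lemma vector_field_along_zero: "vector_field_along A I \<gamma> (\<lambda>t. 0)"
  by (simp add: vector_field_along_def tangent_space_zero smooth_on_const)

lemma vector_field_along_add:
  assumes "open I" "smooth_curve A I \<gamma>" "vector_field_along A I \<gamma> V" "vector_field_along A I \<gamma> W"
  shows "vector_field_along A I \<gamma> (\<lambda>t. V t + W t)"
  using assms by (auto simp: vector_field_along_def tangent_space_add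
      intro!: smooth_on_add open_curve_chart_dom)

lemma cov_deriv_along_zero: "cov_deriv_along A g \<gamma> (\<lambda>t. 0) t = 0"
  by (auto simp: cov_deriv_along_def fun_eq_iff charts_at_iff
      linear_0[OF christoffel_linear[OF _ chart_map_in_image]])

text \<open>Being a field along the curve belongs to the same induction, since the derivative rule
  for the next summand asks it of the partial sum.\<close>

lemma cov_deriv_along_sum:
  assumes "open I" "smooth_curve A I \<gamma>" "t \<in> I" "finite J" "\<And>i. i \<in> J \<Longrightarrow> vector_field_along A I \<gamma> (V i)"
  shows "vector_field_along A I \<gamma> (\<lambda>t. \<Sum>i\<in>J. V i t) \<and>
    cov_deriv_along A g \<gamma> (\<lambda>t. \<Sum>i\<in>J. V i t) t = (\<Sum>i\<in>J. cov_deriv_along A g \<gamma> (V i) t)"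
  using assms(4,5)
proof (induction J rule: finite_induct)
  case empty
  show ?case
    unfolding sum.empty by (intro conjI vector_field_along_zero cov_deriv_along_zero)
next
  case (insert i J)
  have V: "vector_field_along A I \<gamma> (V i)" using insert.prems by blast
  have IH: "vector_field_along A I \<gamma> (\<lambda>t. \<Sum>i\<in>J. V i t)"
    "cov_deriv_along A g \<gamma> (\<lambda>t. \<Sum>i\<in>J. V i t) t = (\<Sum>i\<in>J. cov_deriv_along A g \<gamma> (V i) t)"
    using insert by blast+
  have "cov_deriv_along A g \<gamma> (\<lambda>t. V i t + (\<Sum>i\<in>J. V i t)) t =
      cov_deriv_along A g \<gamma> (V i) t + (\<Sum>i\<in>J. cov_deriv_along A g \<gamma> (V i) t)"
    using cov_deriv_along_combination[OF V IH(1) assms(3) DERIV_const[of 1] DERIV_const[of 1]] IH(2)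
    by simp
  with vector_field_along_add[OF assms(1,2) V IH(1)] show ?case
    by (simp only: sum.insert[OF insert.hyps(1,2)])
qed

lemma vector_field_along_restrict:
  assumes "open I" "smooth_curve A I \<gamma>" "vector_field A Y"
  shows "vector_field_along A I \<gamma> (\<lambda>t. Y (\<gamma> t))"
  unfolding vector_field_along_def
proof (intro conjI ballI)
  show "Y (\<gamma> t) \<in> tangent_space A (\<gamma> t)" for t
    using assms(3) by (rule vector_field_in_tangent_space)
  fix c assume c: "c \<in> A"
  have sm: "smooth_on {t \<in> I. \<gamma> t \<in> chart_dom c} (\<lambda>t. Y (chart_inv c ((chart_map c \<circ> \<gamma>) t)) c)"
    by (rule smooth_on_compose[where T = "chart_image c" and h = "\<lambda>x. Y (chart_inv c x) c"])
      (use assms c in \<open>auto simp: vector_field_def chart_map_in_image intro!: open_curve_chart_dom,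
        simp add: smooth_curve_def o_def\<close>)
  show "smooth_on {t \<in> I. \<gamma> t \<in> chart_dom c} (\<lambda>t. Y (\<gamma> t) c)"
    by (rule smooth_on_cong[OF open_curve_chart_dom[OF assms(1,2) c] sm]) (simp add: chart_inv_map c)
qed

text \<open>Chain rule in a chart; \<open>levi_civita\<close> evaluates \<open>X\<close> only at the
  point itself. This carries the structure equation, stated for fields on the manifold, over to
  curves.\<close>

lemma cov_deriv_along_restrict:
  assumes "open I" "smooth_curve A I \<gamma>" "t \<in> I"
    and "vector_field A Y" "X (\<gamma> t) = velocity A \<gamma> t"
  shows "cov_deriv_along A g \<gamma> (\<lambda>t. Y (\<gamma> t)) t = levi_civita A g X Y (\<gamma> t)"
proof (rule cov_deriv_along_eqI)
  fix c assume c: "c \<in> charts_at A (\<gamma> t)"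
  then have cA: "c \<in> A" "\<gamma> t \<in> chart_dom c" by (auto simp: charts_at_iff)
  have "((\<lambda>x. Y (chart_inv c x) c) has_derivative coord_deriv c Y (\<gamma> t)) (at ((chart_map c \<circ> \<gamma>) t))"
    unfolding coord_deriv_def comp_apply
    by (rule smooth_on_has_derivative[of "chart_image c"])
      (use assms cA in \<open>auto simp: vector_field_def chart_map_in_image\<close>)
  from vector_derivative_diff_chain_within[OF curve_has_velocity[OF assms(2,3) c] has_derivative_at_withinI[OF this]]
  have "((\<lambda>t. Y (chart_inv c (chart_map c (\<gamma> t))) c) has_vector_derivative
      coord_deriv c Y (\<gamma> t) (velocity A \<gamma> t c)) (at t)"
    by (simp add: o_def)
  then have "((\<lambda>t. Y (\<gamma> t) c) has_vector_derivative coord_deriv c Y (\<gamma> t) (velocity A \<gamma> t c)) (at t)"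
    by (rule has_vector_derivative_transform_within_open[OF _ open_curve_chart_dom[OF assms(1,2) cA(1)]])
      (use assms cA in \<open>auto simp: chart_inv_map\<close>)
  then show "\<exists>D. ((\<lambda>t. Y (\<gamma> t) c) has_vector_derivative D) (at t) \<and> levi_civita A g X Y (\<gamma> t) c =
      D + christoffel A g c (chart_map c (\<gamma> t)) (velocity A \<gamma> t c) (Y (\<gamma> t) c)"
    using c assms(5) by (auto simp: levi_civita_def)
qed (simp add: levi_civita_def)

text \<open>In the coordinate product rule, the two Christoffel terms add up to the derivative of
  the metric coefficients along the velocity. Tangency of the covariant derivatives lets
  \<open>g\<close> be evaluated on them in a single chart.\<close>

lemma metric_compatible_along:
  assumes I: "open I" "smooth_curve A I \<gamma>" "t \<in> I"
    and V: "vector_field_along A I \<gamma> V" and W: "vector_field_along A I \<gamma> W"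
    and V': "cov_deriv_along A g \<gamma> V t \<in> tangent_space A (\<gamma> t)"
    and W': "cov_deriv_along A g \<gamma> W t \<in> tangent_space A (\<gamma> t)"
  shows "((\<lambda>t. g (\<gamma> t) (V t) (W t)) has_real_derivative
    g (\<gamma> t) (cov_deriv_along A g \<gamma> V t) (W t) + g (\<gamma> t) (V t) (cov_deriv_along A g \<gamma> W t)) (at t)"
proof -
  obtain c where c: "c \<in> charts_at A (\<gamma> t)" using ex_chart_at by blast
  then have cA: "c \<in> A" "\<gamma> t \<in> chart_dom c" by (auto simp: charts_at_iff)
  define x where "x = chart_map c (\<gamma> t)"
  have x: "x \<in> chart_image c" using cA by (simp add: x_def chart_map_in_image)
  define y' where "y' = velocity A \<gamma> t c"
  define a' where "a' = vector_derivative (\<lambda>t. V t c) (at t)"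
  define b' where "b' = vector_derivative (\<lambda>t. W t c) (at t)"
  note linR = coord_metric_linear_right[OF cA(1) x] and linL = coord_metric_linear_left[OF cA(1) x]
  have "((\<lambda>t. G c ((chart_map c \<circ> \<gamma>) t) (V t c) (W t c)) has_derivative
    (\<lambda>h. DG c x (V t c) (W t c) (h *\<^sub>R y') + G c x (h *\<^sub>R a') (W t c) + G c x (V t c) (h *\<^sub>R b'))) (at t)"
    using coord_metric_product_rule[OF cA(1) _ curve_has_velocity[OF I(2,3) c, unfolded has_vector_derivative_def]
        vector_field_along_has_derivative[OF V I(3) c, unfolded has_vector_derivative_def]
        vector_field_along_has_derivative[OF W I(3) c, unfolded has_vector_derivative_def]] x
    by (simp add: x_def y'_def a'_def b'_def)
  then have "((\<lambda>t. G c ((chart_map c \<circ> \<gamma>) t) (V t c) (W t c)) has_real_derivative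
    DG c x (V t c) (W t c) y' + G c x a' (W t c) + G c x (V t c) b') (at t)"
    unfolding has_field_derivative_def
  proof (rule has_derivative_eq_rhs)
    show "(\<lambda>h. DG c x (V t c) (W t c) (h *\<^sub>R y') + G c x (h *\<^sub>R a') (W t c) + G c x (V t c) (h *\<^sub>R b')) =
      (*) (DG c x (V t c) (W t c) y' + G c x a' (W t c) + G c x (V t c) b')"
      by (rule ext) (simp add: linear_scale[OF DG_linear_direction[OF cA(1) x]] linear_scale[OF linL]
          linear_scale[OF linR] algebra_simps)
  qed
  then have d: "((\<lambda>t. g (\<gamma> t) (V t) (W t)) has_real_derivative
    DG c x (V t c) (W t c) y' + G c x a' (W t c) + G c x (V t c) b') (at t)"
    by (rule has_field_derivative_transform_within_open[OF _ open_curve_chart_dom[OF I(1,2) cA(1)]])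
      (use I V W cA in \<open>auto simp: vector_field_along_def charts_at_iff coord_metric_metric[of _ _ _ c]\<close>)
  have "g (\<gamma> t) (cov_deriv_along A g \<gamma> V t) (W t) = G c x (a' + christoffel A g c x y' (V t c)) (W t c)"
    using coord_metric_metric[OF V' vector_field_along_in_tangent_space[OF W I(3)] c]
    by (simp add: cov_deriv_along_coord[where \<gamma> = \<gamma> and t = t, OF c] x_def a'_def y'_def)
  moreover have "g (\<gamma> t) (V t) (cov_deriv_along A g \<gamma> W t) = G c x (V t c) (b' + christoffel A g c x y' (W t c))"
    using coord_metric_metric[OF vector_field_along_in_tangent_space[OF V I(3)] W' c]
    by (simp add: cov_deriv_along_coord[where \<gamma> = \<gamma> and t = t, OF c] x_def b'_def y'_def)
  ultimately have "DG c x (V t c) (W t c) y' + G c x a' (W t c) + G c x (V t c) b' =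
      g (\<gamma> t) (cov_deriv_along A g \<gamma> V t) (W t) + g (\<gamma> t) (V t) (cov_deriv_along A g \<gamma> W t)"
    using DG_sym[OF cA(1) x, of "V t c" "W t c"]
    by (simp add: linear_add[OF linL] linear_add[OF linR] christoffel_eq[OF cA(1) x]
        coord_metric_sym[OF cA(1) x, of "V t c" "christoffel A g c x y' (W t c)"] field_simps)
  then show ?thesis using d by simp
qed

section \<open>Smoothness of the metric data and of the curvature along a curve\<close>

lemma smooth_on_coord_metric_along:
  assumes "c \<in> A" "open U" "smooth_on U y" "y ` U \<subseteq> chart_image c" "smooth_on U a" "smooth_on U b"
  shows "smooth_on U (\<lambda>t. G c (y t) (a t) (b t))"
proof (rule smooth_on_cong[OF assms(2)])
  show "smooth_on U (\<lambda>t. \<Sum>i\<in>Basis. \<Sum>j\<in>Basis. (a t \<bullet> i) * (b t \<bullet> j) * G c (y t) i j)"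
    by (intro smooth_intros smooth_on_compose[OF metric_smooth[OF assms(1)]] assms)
  show "(\<Sum>i\<in>Basis. \<Sum>j\<in>Basis. (a t \<bullet> i) * (b t \<bullet> j) * G c (y t) i j) = G c (y t) (a t) (b t)"
    if "t \<in> U" for t
    using that assms by (intro coord_metric_expand[symmetric]) auto
qed

lemma smooth_on_DG_along:
  assumes "c \<in> A" "open U" "smooth_on U y" "y ` U \<subseteq> chart_image c" "smooth_on U a" "smooth_on U b" "smooth_on U d"
  shows "smooth_on U (\<lambda>t. DG c (y t) (a t) (b t) (d t))"
proof (rule smooth_on_cong[OF assms(2)])
  have "smooth_on (chart_image c) (\<lambda>x. DG c x i j k)" for i j k
    unfolding DG_def by (intro smooth_on_derivative metric_smooth assms)
  from smooth_on_compose[OF this assms(3,2,4)] have comp: "smooth_on U (\<lambda>t. DG c (y t) i j k)" for i j k .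
  show "smooth_on U (\<lambda>t. \<Sum>k\<in>Basis. (d t \<bullet> k) *\<^sub>R (\<Sum>i\<in>Basis. \<Sum>j\<in>Basis. (a t \<bullet> i) * (b t \<bullet> j) * DG c (y t) i j k))"
    by (intro smooth_on_sum smooth_on_scaleR smooth_on_mult smooth_on_inner smooth_on_const comp assms)
  show "(\<Sum>k\<in>Basis. (d t \<bullet> k) *\<^sub>R (\<Sum>i\<in>Basis. \<Sum>j\<in>Basis. (a t \<bullet> i) * (b t \<bullet> j) * DG c (y t) i j k)) =
    DG c (y t) (a t) (b t) (d t)" if "t \<in> U" for t
  proof -
    have y: "y t \<in> chart_image c" using that assms by auto
    show ?thesis
      by (rule trans[OF _ linear_basis_sum[OF DG_linear_direction[OF assms(1) y], symmetric]])
        (simp only: DG_expand[OF assms(1) y, of "a t" "b t"])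
  qed
qed

text \<open>The curvature is only given as a function on \<open>I\<close>; its smoothness comes from
  \<open>\<kappa> = g(\<nabla>\<^sub>T T, E\<^sub>2)\<close>, which involves the Christoffel symbols of the first kind only.\<close>

lemma curvature_smooth:
  assumes I: "open I" "smooth_curve A I \<gamma>"
    and V: "vector_field_along A I \<gamma> V" "\<And>t. t \<in> I \<Longrightarrow> V t = velocity A \<gamma> t"
    and W: "vector_field_along A I \<gamma> W" "\<And>t. t \<in> I \<Longrightarrow> g (\<gamma> t) (W t) (W t) = 1"
    and k: "\<And>t. t \<in> I \<Longrightarrow> cov_deriv_along A g \<gamma> V t = k t *\<^sub>R W t"
  shows "smooth_on I k"
proof (rule smooth_on_locally)
  fix t assume "t \<in> I"
  obtain c where c: "c \<in> charts_at A (\<gamma> t)" using ex_chart_at by blast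
  then have cA: "c \<in> A" "\<gamma> t \<in> chart_dom c" by (auto simp: charts_at_iff)
  define U where "U = {t \<in> I. \<gamma> t \<in> chart_dom c}"
  have U: "open U" unfolding U_def by (rule open_curve_chart_dom[OF I cA(1)])
  define y where "y = chart_map c \<circ> \<gamma>"
  define a where "a = (\<lambda>t. V t c)"
  define a' where "a' t = vector_derivative a (at t)" for t
  define e where "e = (\<lambda>t. W t c)"
  have sm: "smooth_on U y" "smooth_on U a" "smooth_on U e" "y ` U \<subseteq> chart_image c"
    using I(2) V(1) W(1) cA
    by (auto simp: smooth_curve_def vector_field_along_def U_def y_def a_def e_def chart_map_in_image)
  have sm': "smooth_on U a'" unfolding a'_def[abs_def] by (rule smooth_on_vector_derivative[OF sm(2) U])
  \<comment> \<open>The coordinate formula for the derivative of \<open>V\<close>, paired with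
    \<open>W\<close>. The first two \<open>DG\<close> terms coincide because both arguments of the
    Christoffel symbol are the velocity.\<close>
  have "smooth_on U (\<lambda>t. G c (y t) (a' t) (e t) +
      (DG c (y t) (a t) (e t) (a t) + DG c (y t) (a t) (e t) (a t) - DG c (y t) (a t) (a t) (e t)) * (1 / 2))"
    by (intro smooth_intros smooth_on_DG_along smooth_on_coord_metric_along cA U sm sm')
  moreover have "G c (y t) (a' t) (e t) +
      (DG c (y t) (a t) (e t) (a t) + DG c (y t) (a t) (e t) (a t) - DG c (y t) (a t) (a t) (e t)) * (1 / 2) = k t"
    if t: "t \<in> U" for t
  proof -
    have tI: "t \<in> I" and ct: "c \<in> charts_at A (\<gamma> t)" and x: "y t \<in> chart_image c"
      using t cA by (auto simp: U_def charts_at_iff y_def chart_map_in_image)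
    have tan: "W t \<in> tangent_space A (\<gamma> t)"
      using W(1) tI by (rule vector_field_along_in_tangent_space)
    have "k t = g (\<gamma> t) (k t *\<^sub>R W t) (W t)"
      using W(2)[OF tI] by (simp add: metric_scaleR_left[OF tan tan])
    also have "\<dots> = G c (y t) ((k t *\<^sub>R W t) c) (e t)"
      using coord_metric_metric[OF tangent_space_scaleR[OF tan] tan ct] by (simp add: y_def e_def)
    also have "(k t *\<^sub>R W t) c = a' t + christoffel A g c (y t) (a t) (a t)"
      using k[OF tI] cov_deriv_along_coord[where \<gamma> = \<gamma> and t = t, OF ct, of V] V(2)[OF tI] by (simp add: a'_def a_def y_def)
    finally show ?thesis
      by (simp add: linear_add[OF coord_metric_linear_left[OF cA(1) x]] christoffel_eq[OF cA(1) x])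
  qed
  ultimately have "smooth_on U k" using smooth_on_cong[OF U] by blast
  then show "\<exists>U. open U \<and> t \<in> U \<and> smooth_on U k" using U \<open>t \<in> I\<close> cA by (auto simp: U_def)
qed

section \<open>Frenet curves of osculating order two\<close>

lemma frenet_curve_2D:
  assumes "frenet_curve A g I \<gamma> 2 E \<kappa>"
  shows "smooth_curve A I \<gamma>" "vector_field_along A I \<gamma> (E 1)" "vector_field_along A I \<gamma> (E 2)"
    and "\<And>t. t \<in> I \<Longrightarrow> E 1 t = velocity A \<gamma> t"
    and "\<And>t. t \<in> I \<Longrightarrow> cov_deriv_along A g \<gamma> (E 1) t = \<kappa> 1 t *\<^sub>R E 2 t"
    and "\<And>t. t \<in> I \<Longrightarrow> cov_deriv_along A g \<gamma> (E 2) t = - \<kappa> 1 t *\<^sub>R E 1 t"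
    and "\<And>t. t \<in> I \<Longrightarrow> g (\<gamma> t) (E 1 t) (E 1 t) = 1"
    and "\<And>t. t \<in> I \<Longrightarrow> g (\<gamma> t) (E 2 t) (E 2 t) = 1"
    and "\<And>t. t \<in> I \<Longrightarrow> g (\<gamma> t) (E 1 t) (E 2 t) = 0"
    and "\<And>t. t \<in> I \<Longrightarrow> \<kappa> 1 t > 0"
proof -
  have vf: "\<forall>j\<in>{1..2}. vector_field_along A I \<gamma> (E j)"
    and on: "\<forall>t\<in>I. \<forall>i\<in>{1..2}. \<forall>j\<in>{1..2}. g (\<gamma> t) (E i t) (E j t) = (if i = j then 1 else 0)"
    and k: "\<forall>j\<in>{1..<2}. \<forall>t\<in>I. \<kappa> j t > 0"
    and eq: "\<forall>j\<in>{1..2}. \<forall>t\<in>I. cov_deriv_along A g \<gamma> (E j) t =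
        (if 1 < j then - \<kappa> (j - 1) t *\<^sub>R E (j - 1) t else 0)
        + (if j < 2 then \<kappa> j t *\<^sub>R E (j + 1) t else 0)"
    using assms unfolding frenet_curve_def by blast+
  show "smooth_curve A I \<gamma>" and "\<And>t. t \<in> I \<Longrightarrow> E 1 t = velocity A \<gamma> t"
    using assms unfolding frenet_curve_def by blast+
  show "vector_field_along A I \<gamma> (E 1)" "vector_field_along A I \<gamma> (E 2)"
    by (auto intro: vf[rule_format])
  fix t assume t: "t \<in> I"
  show "g (\<gamma> t) (E 1 t) (E 1 t) = 1" "g (\<gamma> t) (E 2 t) (E 2 t) = 1" "g (\<gamma> t) (E 1 t) (E 2 t) = 0"
    using on[rule_format, OF t, of 1 1] on[rule_format, OF t, of 2 2] on[rule_format, OF t, of 1 2]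
    by simp_all
  show "\<kappa> 1 t > 0" using k t by simp
  show "cov_deriv_along A g \<gamma> (E 1) t = \<kappa> 1 t *\<^sub>R E 2 t"
    and "cov_deriv_along A g \<gamma> (E 2) t = - \<kappa> 1 t *\<^sub>R E 1 t"
    using eq[rule_format, of 1 t] eq[rule_format, of 2 t] t by (simp_all add: numeral_2_eq_2)
qed

text \<open>Here \<open>H = \<kappa> E\<^sub>2\<close> has derivative
  \<open>- \<kappa>\<^sup>2 E\<^sub>1 + \<kappa>' E\<^sub>2\<close>; one more use of the Frenet
  equations and a change of sign give the formula.\<close>

lemma laplacian_mean_curvature_frenet2:
  assumes I: "open I" and fr: "frenet_curve A g I \<gamma> 2 E \<kappa>" and t: "t \<in> I"
    and k1: "\<And>t. t \<in> I \<Longrightarrow> (\<kappa> 1 has_real_derivative k1 t) (at t)"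
    and k2: "\<And>t. t \<in> I \<Longrightarrow> (k1 has_real_derivative k2 t) (at t)"
  shows "laplacian_along A g \<gamma> (mean_curvature A g \<gamma>) t =
    (3 * \<kappa> 1 t * k1 t) *\<^sub>R E 1 t + (\<kappa> 1 t ^ 3 - k2 t) *\<^sub>R E 2 t"
proof -
  note fr2 = frenet_curve_2D[OF fr]
  note E = fr2(2,3) and vel = fr2(4) and f1 = fr2(5) and f2 = fr2(6)
  have H: "mean_curvature A g \<gamma> t = \<kappa> 1 t *\<^sub>R E 2 t" if "t \<in> I" for t
    unfolding mean_curvature_def
    using cov_deriv_along_cong[OF I that vel, where \<gamma> = \<gamma>] f1[OF that] by simp
  have H1: "cov_deriv_along A g \<gamma> (mean_curvature A g \<gamma>) t = (- (\<kappa> 1 t)\<^sup>2) *\<^sub>R E 1 t + k1 t *\<^sub>R E 2 t"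
    if "t \<in> I" for t
  proof -
    have "cov_deriv_along A g \<gamma> (mean_curvature A g \<gamma>) t = cov_deriv_along A g \<gamma> (\<lambda>t. \<kappa> 1 t *\<^sub>R E 2 t) t"
      by (rule cov_deriv_along_cong[OF I that H])
    then show ?thesis
      unfolding cov_deriv_along_scaleR[OF E(2) that k1[OF that]] f2[OF that]
      by (simp add: power2_eq_square)
  qed
  have d: "((\<lambda>t. - (\<kappa> 1 t)\<^sup>2) has_real_derivative - 2 * \<kappa> 1 t * k1 t) (at t)"
    by (rule derivative_eq_intros k1[OF t] refl)+ simp
  have "cov_deriv_along A g \<gamma> (cov_deriv_along A g \<gamma> (mean_curvature A g \<gamma>)) t =
    cov_deriv_along A g \<gamma> (\<lambda>t. (- (\<kappa> 1 t)\<^sup>2) *\<^sub>R E 1 t + k1 t *\<^sub>R E 2 t) t"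
    by (rule cov_deriv_along_cong[OF I t H1])
  also have "\<dots> = (- 2 * \<kappa> 1 t * k1 t) *\<^sub>R E 1 t + (- (\<kappa> 1 t)\<^sup>2) *\<^sub>R \<kappa> 1 t *\<^sub>R E 2 t +
      (k2 t *\<^sub>R E 2 t + k1 t *\<^sub>R - \<kappa> 1 t *\<^sub>R E 1 t)"
    unfolding cov_deriv_along_combination[OF E t d k2[OF t]] f1[OF t] f2[OF t] ..
  also have "\<dots> = (- 3 * \<kappa> 1 t * k1 t) *\<^sub>R E 1 t + (k2 t - \<kappa> 1 t ^ 3) *\<^sub>R E 2 t"
    by (simp add: algebra_simps power2_eq_square power3_eq_cube flip: scaleR_add_left)
  finally show ?thesis
    unfolding laplacian_along_def by (simp add: algebra_simps)
qed

end

section \<open>Legendre curves in trans-S-manifolds\<close>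

context trans_S_manifold
begin

text \<open>Apply the defining equation to \<open>\<xi>\<^sub>j\<close>, so that \<open>f(\<nabla>\<^sub>X \<xi>\<^sub>j)\<close> is known, and recover the metric
  components of \<open>\<nabla>\<^sub>X \<xi>\<^sub>j\<close> from the compatibility of \<open>g\<close> and \<open>f\<close>.\<close>

lemma levi_civita_xi_components:
  assumes X: "vector_field A X" and j: "j \<in> {1..s}"
    and leg: "\<And>i. i \<in> {1..s} \<Longrightarrow> \<eta> i p (X p) = 0"
  defines "L \<equiv> levi_civita A g X (\<xi> j) p"
  shows "g p L (X p) = \<beta> j p * g p (X p) (X p)"
    and "g p L (f p (X p)) = - \<alpha> j p * g p (X p) (X p)"
    and "g p (X p) (f p (X p)) = 0"
proof -
  define x where "x = X p"
  note xi = \<xi>_field[OF j]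
  have x: "x \<in> tangent_space A p" and L: "L \<in> tangent_space A p"
    and xip: "\<And>i. i \<in> {1..s} \<Longrightarrow> \<xi> i p \<in> tangent_space A p"
    using X \<xi>_field xi by (auto simp: x_def L_def vector_field_in_tangent_space levi_civita_in_tangent_space)
  have f_tan: "f p v \<in> tangent_space A p" if "v \<in> tangent_space A p" for v
    using f_field that by (auto simp: endo_field_def)
  note fx = f_tan[OF x]
  \<comment> \<open>The Legendre condition removes the \<open>\<xi> i\<close> terms from the square
    of \<open>f\<close> at \<open>x\<close>.\<close>
  have ffx: "f p (f p x) = - x"
    using f_squared[OF x] leg by (simp add: x_def)
  have minus: "g p v (- w) = - g p v w" if "v \<in> tangent_space A p" "w \<in> tangent_space A p" for v w
    using metric_scaleR_right[OF that, of "-1"] by simp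
  have gff: "g p (f p v) (f p x) = g p v x" if "v \<in> tangent_space A p" for v
    using metric_f[OF that x] leg by (simp add: x_def)
  \<comment> \<open>\<open>f\<close> is skew-adjoint against \<open>x\<close>: apply the
    compatibility of \<open>g\<close> and \<open>f\<close> to \<open>v\<close> and
    \<open>f p x\<close>, then \<open>ffx\<close>.\<close>
  have gffx: "g p (f p v) x = - g p v (f p x)" if "v \<in> tangent_space A p" for v
    using metric_f[OF that fx] \<eta>_f[OF _ x] minus[OF f_tan[OF that] x] by (simp add: ffx)
  have xfx: "g p x (f p x) = 0"
    using gffx[OF x] metric_sym[OF fx x] by simp
  \<comment> \<open>The first term of the covariant derivative of \<open>f\<close> on
    \<open>\<xi> j\<close> differentiates the zero field, which leaves
    \<open>- f p L\<close>.\<close>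
  have "- f p L = (\<Sum>i\<in>{1..s}.
       \<alpha> i p *\<^sub>R (g p (f p x) (f p (\<xi> j p)) *\<^sub>R \<xi> i p + \<eta> i p (\<xi> j p) *\<^sub>R f p (f p x))
     + \<beta> i p *\<^sub>R (g p (f p x) (\<xi> j p) *\<^sub>R \<xi> i p - \<eta> i p (\<xi> j p) *\<^sub>R f p x))"
    using trans_S[OF X xi, of p]
    by (simp add: cov_deriv_endo_def f_\<xi>[OF j] levi_civita_zero L_def x_def)
  \<comment> \<open>Both metric factors vanish, as \<open>\<xi> j\<close> is annihilated by
    \<open>f\<close> and orthogonal to \<open>f p x\<close>; the remaining factor is a Kronecker
    delta.\<close>
  also have "\<dots> = (\<Sum>i\<in>{1..s}. if i = j then \<alpha> i p *\<^sub>R - x - \<beta> i p *\<^sub>R f p x else 0)"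
    using \<eta>_metric[OF j fx] \<eta>_f[OF j x]
    by (intro sum.cong refl)
      (auto simp: \<eta>_\<xi> j f_\<xi> metric_zero_right fx ffx simp del: One_nat_def atLeastAtMost_iff)
  also have "\<dots> = \<alpha> j p *\<^sub>R - x - \<beta> j p *\<^sub>R f p x"
    using j by (simp add: sum.delta)
  finally have "- f p L = \<alpha> j p *\<^sub>R - x - \<beta> j p *\<^sub>R f p x" .
  then have fL: "f p L = \<alpha> j p *\<^sub>R x + \<beta> j p *\<^sub>R f p x"
    by (metis (no_types, lifting) add.inverse_inverse minus_diff_eq scaleR_minus_right diff_minus_eq_add add.commute)
  have "g p L x = g p (f p L) (f p x)" using gff[OF L] by simp
  also have "\<dots> = \<beta> j p * g p x x"
    using xfx gff[OF x] x fx
    by (simp add: fL metric_add_left metric_scaleR_left tangent_space_scaleR)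
  finally show "g p L (X p) = \<beta> j p * g p (X p) (X p)" by (simp add: x_def)
  have "g p L (f p x) = - g p (f p L) x" using gffx[OF L] by simp
  also have "\<dots> = - \<alpha> j p * g p x x"
    using xfx metric_sym[OF x fx] x fx
    by (simp add: fL metric_add_left metric_scaleR_left tangent_space_scaleR)
  finally show "g p L (f p (X p)) = - \<alpha> j p * g p (X p) (X p)" by (simp add: x_def)
  show "g p (X p) (f p (X p)) = 0" using xfx by (simp add: x_def)
qed

section \<open>The sum of the structure vector fields\<close>

lemma xi_in_tangent_space: "i \<in> {1..s} \<Longrightarrow> \<xi> i p \<in> tangent_space A p"
  using \<xi>_field vector_field_in_tangent_space by blast

lemma metric_xi_sum:
  assumes "v \<in> tangent_space A p"
  shows "g p v (\<Sum>i\<in>{1..s}. \<xi> i p) = (\<Sum>i\<in>{1..s}. \<eta> i p v)"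
proof -
  have "g p v (\<Sum>i\<in>{1..s}. \<xi> i p) = (\<Sum>i\<in>{1..s}. g p v (\<xi> i p))"
    by (rule metric_sum_right[OF assms xi_in_tangent_space])
  also have "\<dots> = (\<Sum>i\<in>{1..s}. \<eta> i p v)"
    by (intro sum.cong refl \<eta>_metric[symmetric] assms)
  finally show ?thesis .
qed

text \<open>Additivity of \<open>\<eta> j\<close> is read off from the metric: pairing with
  \<open>\<xi> j\<close> produces a sum of Kronecker deltas.\<close>

lemma eta_xi_sum:
  assumes "j \<in> {1..s}"
  shows "\<eta> j p (\<Sum>i\<in>{1..s}. \<xi> i p) = 1"
proof -
  have "\<eta> j p (\<Sum>i\<in>{1..s}. \<xi> i p) = g p (\<Sum>i\<in>{1..s}. \<xi> i p) (\<xi> j p)"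
    by (rule \<eta>_metric[OF assms tangent_space_sum[OF xi_in_tangent_space]])
  also have "\<dots> = (\<Sum>i\<in>{1..s}. g p (\<xi> i p) (\<xi> j p))"
    by (rule metric_sum_left[OF xi_in_tangent_space[OF assms] xi_in_tangent_space])
  also have "\<dots> = (\<Sum>i\<in>{1..s}. if i = j then 1 else 0)"
    by (intro sum.cong refl) (simp add: \<eta>_metric[symmetric] xi_in_tangent_space \<eta>_\<xi> assms
        del: One_nat_def atLeastAtMost_iff)
  also have "\<dots> = 1" using assms by (simp add: sum.delta)
  finally show ?thesis .
qed

lemma eta_scaleR:
  "j \<in> {1..s} \<Longrightarrow> v \<in> tangent_space A p \<Longrightarrow> \<eta> j p (r *\<^sub>R v) = r * \<eta> j p v"
  by (simp add: \<eta>_metric tangent_space_scaleR metric_scaleR_left xi_in_tangent_space)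

text \<open>Gives the length \<open>sqrt (real s)\<close> by which the sum is normalised to become
  \<open>E 2\<close>.\<close>

lemma metric_xi_sum_self: "g p (\<Sum>i\<in>{1..s}. \<xi> i p) (\<Sum>i\<in>{1..s}. \<xi> i p) = real s"
proof -
  have "g p (\<Sum>i\<in>{1..s}. \<xi> i p) (\<Sum>i\<in>{1..s}. \<xi> i p) =
      (\<Sum>j\<in>{1..s}. \<eta> j p (\<Sum>i\<in>{1..s}. \<xi> i p))"
    by (rule metric_xi_sum[OF tangent_space_sum[OF xi_in_tangent_space]])
  also have "\<dots> = (\<Sum>j\<in>{1..s}. 1)"
    by (intro sum.cong refl eta_xi_sum)
  finally show ?thesis by simp
qed

lemma s_positive: "real s > 0"
  using s_pos by simp

section \<open>Consequences of C-properness, and the converse\<close>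

text \<open>One pair \<open>\<epsilon>\<close>, \<open>b\<close> serves all conclusions:
  \<open>\<epsilon>\<close> is the sign of \<open>l\<close> and \<open>b\<close> the common value of
  the \<open>\<beta> i\<close>. Both the forward implication and the supplementary claims of the
  theorem are read off from here.\<close>

lemma legendre_frenet2_C_proper:
  assumes I: "open I" "is_interval I" and fr: "frenet_curve A g I \<gamma> 2 E \<kappa>"
    and leg: "legendre_curve A s \<eta> I \<gamma>" and C: "C_proper_tangent A g s \<xi> I \<gamma> l" and "I \<noteq> {}"
  shows "\<exists>\<epsilon>\<in>{1, -1}. \<exists>b::real. circle_curve A g I \<gamma> E \<kappa> \<and>
         (\<forall>i\<in>{1..s}. \<forall>t\<in>I. \<beta> i (\<gamma> t) = b) \<and>
         (\<forall>t\<in>I. \<kappa> 1 t = - \<epsilon> * sqrt (real s) * b) \<and>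
         (\<forall>t\<in>I. E 2 t = (\<epsilon> / sqrt (real s)) *\<^sub>R (\<Sum>i\<in>{1..s}. \<xi> i (\<gamma> t))) \<and>
         (\<forall>t\<in>I. l t = - real s * b ^ 3) \<and>
         (\<forall>t\<in>I. (\<Sum>i\<in>{1..s}. \<alpha> i (\<gamma> t)) = 0)"
proof -
  note One_nat_def [simp del] and fr2 = frenet_curve_2D[OF fr]
  note sc = fr2(1) and E = fr2(2,3) and vel = fr2(4) and f1 = fr2(5) and f2 = fr2(6)
    and on = fr2(7,8,9) and kpos = fr2(10)
  note tan = E[THEN vector_field_along_in_tangent_space]
  define S where "S t = (\<Sum>i\<in>{1..s}. \<xi> i (\<gamma> t))" for t
  have S_tan: "S t \<in> tangent_space A (\<gamma> t)" for t
    unfolding S_def by (intro tangent_space_sum xi_in_tangent_space)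
  have legE: "\<eta> i (\<gamma> t) (E 1 t) = 0" if "i \<in> {1..s}" "t \<in> I" for i t
    using leg that vel by (simp add: legendre_curve_def)
  have ES: "g (\<gamma> t) (E 1 t) (S t) = 0" if "t \<in> I" for t
    using legE that unfolding S_def metric_xi_sum[OF tan(1)[OF that]] by simp
  have ldiff: "\<And>t. t \<in> I \<Longrightarrow> l differentiable (at t)" and lnz: "\<And>t. t \<in> I \<Longrightarrow> l t \<noteq> 0"
    and lap: "\<And>t. t \<in> I \<Longrightarrow> laplacian_along A g \<gamma> (mean_curvature A g \<gamma>) t = l t *\<^sub>R S t"
    using C by (auto simp: C_proper_tangent_def S_def)

  define k1 where "k1 t = vector_derivative (\<kappa> 1) (at t)" for t
  define k2 where "k2 t = vector_derivative k1 (at t)" for t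
  have sm: "smooth_on I (\<kappa> 1)"
    by (rule curvature_smooth[OF I(1) sc E(1) vel E(2) on(2) f1])
  have sm1: "smooth_on I k1"
    unfolding k1_def[abs_def] by (rule smooth_on_vector_derivative[OF sm I(1)])
  have k1: "(\<kappa> 1 has_real_derivative k1 t) (at t)" if "t \<in> I" for t
    using smooth_on_has_vector_derivative[OF sm that]
    by (simp add: k1_def has_real_derivative_iff_has_vector_derivative)
  have k2: "(k1 has_real_derivative k2 t) (at t)" if "t \<in> I" for t
    using smooth_on_has_vector_derivative[OF sm1 that]
    by (simp add: k2_def has_real_derivative_iff_has_vector_derivative)
  have eq: "(3 * \<kappa> 1 t * k1 t) *\<^sub>R E 1 t + (\<kappa> 1 t ^ 3 - k2 t) *\<^sub>R E 2 t = l t *\<^sub>R S t" if "t \<in> I" for t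
    using laplacian_mean_curvature_frenet2[OF I(1) fr that k1 k2] lap[OF that] by simp
  \<comment> \<open>\<open>E 1\<close> is orthogonal to \<open>E 2\<close> and to \<open>S\<close>,
    so pairing \<open>eq\<close> with it leaves \<open>3 * \<kappa> 1 t * k1 t = 0\<close>.\<close>
  have k1_0: "k1 t = 0" if "t \<in> I" for t
  proof -
    have "g (\<gamma> t) (E 1 t) ((3 * \<kappa> 1 t * k1 t) *\<^sub>R E 1 t + (\<kappa> 1 t ^ 3 - k2 t) *\<^sub>R E 2 t) = 3 * \<kappa> 1 t * k1 t"
      using tan[OF that] on[OF that]
      by (simp add: metric_add_right metric_scaleR_right tangent_space_scaleR)
    moreover have "g (\<gamma> t) (E 1 t) (l t *\<^sub>R S t) = 0"
      using ES[OF that] by (simp add: metric_scaleR_right tan that S_tan)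
    ultimately show ?thesis using eq[OF that] kpos[OF that] by simp
  qed
  have k2_0: "k2 t = 0" if "t \<in> I" for t
  proof -
    have "((\<lambda>t. 0) has_real_derivative k2 t) (at t)"
      by (rule has_field_derivative_transform_within_open[OF k2[OF that] I(1) that k1_0])
    then show ?thesis using DERIV_unique DERIV_const by blast
  qed
  obtain K where K: "\<And>t. t \<in> I \<Longrightarrow> \<kappa> 1 t = K"
    using has_field_derivative_zero_constant[of I "\<kappa> 1"] k1 k1_0 I(2)
    by (metis at_within_open[OF _ I(1)] is_interval_convex)
  have Kpos: "K > 0" using \<open>I \<noteq> {}\<close> kpos K by fastforce
  have eq3: "K ^ 3 *\<^sub>R E 2 t = l t *\<^sub>R S t" if "t \<in> I" for t
    using eq[OF that] by (simp add: k1_0[OF that] k2_0[OF that] K[OF that])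
  have SS: "g (\<gamma> t) (S t) (S t) = real s" for t
    unfolding S_def by (rule metric_xi_sum_self)
  \<comment> \<open>Compare the squared lengths of the two sides of \<open>eq3\<close>.\<close>
  have lK: "\<bar>l t\<bar> * sqrt (real s) = K ^ 3" if "t \<in> I" for t
  proof -
    have "g (\<gamma> t) (K ^ 3 *\<^sub>R E 2 t) (K ^ 3 *\<^sub>R E 2 t) = (K ^ 3)\<^sup>2"
      using tan[OF that] on[OF that]
      by (simp add: metric_scaleR_left metric_scaleR_right tangent_space_scaleR power2_eq_square)
    moreover have "g (\<gamma> t) (l t *\<^sub>R S t) (l t *\<^sub>R S t) = (l t)\<^sup>2 * real s"
      by (simp add: metric_scaleR_left metric_scaleR_right tangent_space_scaleR S_tan SS power2_eq_square)
    ultimately have "(\<bar>l t\<bar> * sqrt (real s))\<^sup>2 = (K ^ 3)\<^sup>2"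
      using eq3[OF that] by (simp add: power_mult_distrib)
    then show ?thesis by (rule power2_eq_imp_eq) (use Kpos in auto)
  qed
  \<comment> \<open>\<open>l\<close> is continuous without zeros on the connected set
    \<open>I\<close>, so its sign is the same everywhere; it becomes the sign in the Frenet
    frame.\<close>
  obtain \<epsilon> :: real where \<epsilon>: "\<epsilon> \<in> {1, -1}" "\<And>t. t \<in> I \<Longrightarrow> l t = \<epsilon> * \<bar>l t\<bar>"
  proof -
    have cont: "continuous_on I l"
      using ldiff by (auto intro!: continuous_at_imp_continuous_on differentiable_imp_continuous_within)
    have "connected (l ` I)"
      using connected_continuous_image[OF cont] I(2) is_interval_connected by blast
    moreover have "0 \<notin> l ` I" using lnz by auto
    ultimately have "\<not> (l t1 < 0 \<and> l t2 > 0)" if "t1 \<in> I" "t2 \<in> I" for t1 t2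
      using connectedD_interval[of "l ` I" "l t1" "l t2" 0] that by auto
    then have "(\<forall>t\<in>I. l t > 0) \<or> (\<forall>t\<in>I. l t < 0)"
      using lnz by (meson linorder_neqE_linordered_idom)
    then show ?thesis
    proof
      assume "\<forall>t\<in>I. l t > 0" then show ?thesis by (intro that[of 1]) auto
    next
      assume "\<forall>t\<in>I. l t < 0" then show ?thesis by (intro that[of "-1"]) auto
    qed
  qed
  have \<epsilon>2: "\<epsilon> * \<epsilon> = 1" using \<epsilon>(1) by auto
  have l: "l t = \<epsilon> * K ^ 3 / sqrt (real s)" if "t \<in> I" for t
  proof -
    have "l t * sqrt (real s) = \<epsilon> * (\<bar>l t\<bar> * sqrt (real s))"
      using \<epsilon>(2)[OF that] by (metis mult.assoc)
    then show ?thesis using s_positive by (simp add: lK[OF that] field_simps)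
  qed
  have E2: "E 2 t = (\<epsilon> / sqrt (real s)) *\<^sub>R S t" if "t \<in> I" for t
  proof -
    have "K ^ 3 *\<^sub>R E 2 t = K ^ 3 *\<^sub>R (\<epsilon> / sqrt (real s)) *\<^sub>R S t"
      using eq3[OF that] by (simp add: l[OF that] mult.commute)
    then show ?thesis by (rule scaleR_left_imp_eq[rotated]) (use Kpos in simp)
  qed
  \<comment> \<open>Solves \<open>K = - \<epsilon> * sqrt (real s) * b\<close> for \<open>b\<close>;
    \<open>\<epsilon>\<close> is its own inverse.\<close>
  define b where "b = - K * \<epsilon> / sqrt (real s)"

  have xi_along: "vector_field_along A I \<gamma> (\<lambda>t. \<xi> i (\<gamma> t))" if "i \<in> {1..s}" for i
    using vector_field_along_restrict[OF I(1) sc \<xi>_field[OF that]] .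
  have xi: "cov_deriv_along A g \<gamma> (\<lambda>t. \<xi> j (\<gamma> t)) t \<in> tangent_space A (\<gamma> t) \<and>
      g (\<gamma> t) (cov_deriv_along A g \<gamma> (\<lambda>t. \<xi> j (\<gamma> t)) t) (E 1 t) = \<beta> j (\<gamma> t) \<and>
      g (\<gamma> t) (cov_deriv_along A g \<gamma> (\<lambda>t. \<xi> j (\<gamma> t)) t) (f (\<gamma> t) (E 1 t)) = - \<alpha> j (\<gamma> t) \<and>
      g (\<gamma> t) (E 1 t) (f (\<gamma> t) (E 1 t)) = 0"
    if j: "j \<in> {1..s}" and t: "t \<in> I" for j t
  proof -
    \<comment> \<open>The components of the derivative of \<open>\<xi> j\<close> are known for
      fields on the manifold, so for each \<open>t\<close> a separate \<open>X\<close> extends the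
      single vector \<open>E 1 t\<close>.\<close>
    obtain X where X: "vector_field A X" "X (\<gamma> t) = E 1 t"
      using ex_vector_field_extending[OF tan(1)[OF t]] by blast
    have L: "cov_deriv_along A g \<gamma> (\<lambda>t. \<xi> j (\<gamma> t)) t = levi_civita A g X (\<xi> j) (\<gamma> t)"
      using X(2) vel[OF t] by (intro cov_deriv_along_restrict[OF I(1) sc t \<xi>_field[OF j]]) simp
    show ?thesis
      using levi_civita_xi_components[OF X(1) j, of "\<gamma> t"] legE[OF _ t] on(1)[OF t]
        levi_civita_in_tangent_space[OF X(1) \<xi>_field[OF j]]
      by (simp add: L X(2))
  qed
  \<comment> \<open>Differentiating \<open>g(T, \<xi>\<^sub>j) = 0\<close> gives \<open>0 = K *
    (\<epsilon> / sqrt (real s)) + \<beta> j (\<gamma> t)\<close>.\<close>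
  have beta: "\<beta> j (\<gamma> t) = b" if j: "j \<in> {1..s}" and t: "t \<in> I" for j t
  proof -
    have d1: "cov_deriv_along A g \<gamma> (E 1) t \<in> tangent_space A (\<gamma> t)"
      using f1[OF t] tan(2)[OF t] by (simp add: tangent_space_scaleR)
    have "((\<lambda>t. g (\<gamma> t) (E 1 t) (\<xi> j (\<gamma> t))) has_real_derivative
      g (\<gamma> t) (cov_deriv_along A g \<gamma> (E 1) t) (\<xi> j (\<gamma> t)) +
      g (\<gamma> t) (E 1 t) (cov_deriv_along A g \<gamma> (\<lambda>t. \<xi> j (\<gamma> t)) t)) (at t)"
      using metric_compatible_along[OF I(1) sc t E(1) xi_along[OF j] d1] xi[OF j t] by blast
    moreover have "((\<lambda>t. g (\<gamma> t) (E 1 t) (\<xi> j (\<gamma> t))) has_real_derivative 0) (at t)"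
      by (rule has_field_derivative_transform_within_open[OF DERIV_const[of 0] I(1) t])
        (use \<eta>_metric[OF j tan(1)] legE[OF j] in simp)
    ultimately have "0 = g (\<gamma> t) (cov_deriv_along A g \<gamma> (E 1) t) (\<xi> j (\<gamma> t)) +
      g (\<gamma> t) (E 1 t) (cov_deriv_along A g \<gamma> (\<lambda>t. \<xi> j (\<gamma> t)) t)"
      using DERIV_unique by blast
    also have "g (\<gamma> t) (cov_deriv_along A g \<gamma> (E 1) t) (\<xi> j (\<gamma> t)) = K * \<eta> j (\<gamma> t) (E 2 t)"
      unfolding f1[OF t] K[OF t] metric_scaleR_left[OF tan(2)[OF t] xi_in_tangent_space[OF j]]
        \<eta>_metric[OF j tan(2)[OF t]] ..
    also have "\<eta> j (\<gamma> t) (E 2 t) = \<epsilon> / sqrt (real s)"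
      unfolding E2[OF t] eta_scaleR[OF j S_tan] unfolding S_def eta_xi_sum[OF j] by simp
    also have "g (\<gamma> t) (E 1 t) (cov_deriv_along A g \<gamma> (\<lambda>t. \<xi> j (\<gamma> t)) t) = \<beta> j (\<gamma> t)"
      using xi[OF j t] metric_sym[OF tan(1)[OF t]] by simp
    finally show ?thesis by (simp add: b_def)
  qed
  have alpha: "(\<Sum>i\<in>{1..s}. \<alpha> i (\<gamma> t)) = 0" if t: "t \<in> I" for t
  proof -
    let ?F = "f (\<gamma> t) (E 1 t)" and ?D = "\<lambda>i. cov_deriv_along A g \<gamma> (\<lambda>t. \<xi> i (\<gamma> t)) t"
    have F: "?F \<in> tangent_space A (\<gamma> t)"
      using f_field tan(1)[OF t] by (auto simp: endo_field_def)
    have S: "vector_field_along A I \<gamma> S" "cov_deriv_along A g \<gamma> S t = (\<Sum>i\<in>{1..s}. ?D i)"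
      using cov_deriv_along_sum[OF I(1) sc t, of "{1..s}" "\<lambda>i t. \<xi> i (\<gamma> t)"] xi_along
      unfolding S_def[abs_def] by auto
    \<comment> \<open>The derivative of \<open>E 2\<close> is computed twice, by the Frenet equation
      and from the constant multiple of \<open>S\<close> that equals \<open>E 2\<close>; the results
      are then compared along \<open>f T\<close>.\<close>
    have "- K *\<^sub>R E 1 t = cov_deriv_along A g \<gamma> (E 2) t"
      using f2[OF t] K[OF t] by simp
    also have "\<dots> = cov_deriv_along A g \<gamma> (\<lambda>t. (\<epsilon> / sqrt (real s)) *\<^sub>R S t) t"
      by (rule cov_deriv_along_cong[OF I(1) t E2])
    also have "\<dots> = (\<epsilon> / sqrt (real s)) *\<^sub>R (\<Sum>i\<in>{1..s}. ?D i)"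
      using cov_deriv_along_scaleR[OF S(1) t DERIV_const] S(2) by simp
    finally have *: "- K *\<^sub>R E 1 t = (\<epsilon> / sqrt (real s)) *\<^sub>R (\<Sum>i\<in>{1..s}. ?D i)" .
    have D: "?D i \<in> tangent_space A (\<gamma> t)" if "i \<in> {1..s}" for i
      using xi[OF that t] by blast
    \<comment> \<open>Each instance of \<open>xi\<close> contains this orthogonality;
      \<open>s \<ge> 1\<close> makes the index 1 available.\<close>
    have "g (\<gamma> t) (E 1 t) ?F = 0" using xi[OF _ t, of 1] s_pos by simp
    then have "0 = g (\<gamma> t) (- K *\<^sub>R E 1 t) ?F"
      using metric_scaleR_left[OF tan(1)[OF t] F, of "- K"] by simp
    also have "\<dots> = (\<epsilon> / sqrt (real s)) * g (\<gamma> t) (\<Sum>i\<in>{1..s}. ?D i) ?F"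
      unfolding * by (rule metric_scaleR_left[OF tangent_space_sum[OF D] F])
    also have "g (\<gamma> t) (\<Sum>i\<in>{1..s}. ?D i) ?F = (\<Sum>i\<in>{1..s}. g (\<gamma> t) (?D i) ?F)"
      by (rule metric_sum_left[OF F D])
    also have "\<dots> = (\<Sum>i\<in>{1..s}. - \<alpha> i (\<gamma> t))"
      using xi[OF _ t] by (intro sum.cong refl) blast
    finally show ?thesis
      using \<epsilon>(1) s_positive by (auto simp: sum_negf)
  qed
  have kb: "\<kappa> 1 t = - \<epsilon> * sqrt (real s) * b" if "t \<in> I" for t
  proof -
    have "- \<epsilon> * sqrt (real s) * b = (\<epsilon> * \<epsilon>) * K"
      using s_positive by (simp add: b_def)
    then show ?thesis using K[OF that] \<epsilon>2 by simp
  qed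
  have lb: "l t = - real s * b ^ 3" if "t \<in> I" for t
  proof -
    \<comment> \<open>The denominator of \<open>b ^ 3\<close>; its factor \<open>real s\<close>
      cancels the one in \<open>- real s * b ^ 3\<close>.\<close>
    have "sqrt (real s) ^ 3 = real s * sqrt (real s)"
      by (simp add: power3_eq_cube)
    then have "- real s * b ^ 3 = (\<epsilon> * \<epsilon>) * \<epsilon> * K ^ 3 / sqrt (real s)"
      using s_positive by (simp add: b_def power_divide power_mult_distrib) (simp add: power3_eq_cube)
    then show ?thesis using l[OF that] \<epsilon>2 by simp
  qed
  have "circle_curve A g I \<gamma> E \<kappa>"
    using fr K Kpos by (auto simp: circle_curve_def)
  then show ?thesis
    using \<epsilon>(1) beta alpha kb lb E2 by (intro bexI[of _ \<epsilon>] exI[of _ b]) (auto simp: S_def)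
qed

text \<open>With constant curvature \<open>K\<close> the Laplacian is
  \<open>K ^ 3 *\<^sub>R E 2 t\<close>, so the constant
  \<open>K ^ 3 * \<epsilon> / sqrt (real s)\<close> is a suitable \<lambda>.\<close>

lemma circle_C_proper:
  assumes I: "open I" and circ: "circle_curve A g I \<gamma> E \<kappa>" and "\<epsilon> \<noteq> 0"
    and E2: "\<And>t. t \<in> I \<Longrightarrow> E 2 t = (\<epsilon> / sqrt (real s)) *\<^sub>R (\<Sum>i\<in>{1..s}. \<xi> i (\<gamma> t))"
  shows "\<exists>l. C_proper_tangent A g s \<xi> I \<gamma> l"
proof -
  obtain K where fr: "frenet_curve A g I \<gamma> 2 E \<kappa>" and K: "K > 0" "\<And>t. t \<in> I \<Longrightarrow> \<kappa> 1 t = K"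
    using circ by (auto simp: circle_curve_def)
  note One_nat_def [simp del]
  have k1: "(\<kappa> 1 has_real_derivative 0) (at t)" if "t \<in> I" for t
    by (rule has_field_derivative_transform_within_open[OF DERIV_const[of K] I that]) (simp only: K(2))
  have "laplacian_along A g \<gamma> (mean_curvature A g \<gamma>) t =
      (K ^ 3 * \<epsilon> / sqrt (real s)) *\<^sub>R (\<Sum>i\<in>{1..s}. \<xi> i (\<gamma> t))" if "t \<in> I" for t
    using laplacian_mean_curvature_frenet2[OF I fr that k1 DERIV_const[of 0]]
    by (simp add: K(2)[OF that] E2[OF that])
  then have "C_proper_tangent A g s \<xi> I \<gamma> (\<lambda>t. K ^ 3 * \<epsilon> / sqrt (real s))"
    using K(1) \<open>\<epsilon> \<noteq> 0\<close> s_positive by (auto simp: C_proper_tangent_def)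
  then show ?thesis by blast
qed

end

text \<open>\<open>\<epsilon>\<close> ties the sign of the curvature to the sign of the frame field,
  \<open>\<epsilon> = 1\<close> giving the upper signs, and \<open>b\<close> is the constant written
  \<beta>. The supplementary claims are made for every \<lambda> with which the curve is
  C-proper.\<close>

theorem theorem5:
  fixes A :: "('a::{t2_space, second_countable_topology}, 'e::euclidean_space) chart set"
    and g :: "'a \<Rightarrow> ('a, 'e) tangent \<Rightarrow> ('a, 'e) tangent \<Rightarrow> real"
    and n s :: nat
    and f :: "'a \<Rightarrow> ('a, 'e) tangent \<Rightarrow> ('a, 'e) tangent"
    and \<xi> :: "nat \<Rightarrow> 'a \<Rightarrow> ('a, 'e) tangent"
    and \<eta> :: "nat \<Rightarrow> 'a \<Rightarrow> ('a, 'e) tangent \<Rightarrow> real"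
    and \<alpha> \<beta> :: "nat \<Rightarrow> 'a \<Rightarrow> real"
    and I :: "real set" and \<gamma> :: "real \<Rightarrow> 'a"
    and E :: "nat \<Rightarrow> real \<Rightarrow> ('a, 'e) tangent" and \<kappa> :: "nat \<Rightarrow> real \<Rightarrow> real"
  assumes "trans_S_manifold A g n s f \<xi> \<eta> \<alpha> \<beta>"
    and "open I" and "is_interval I" and "I \<noteq> {}"
    and "frenet_curve A g I \<gamma> 2 E \<kappa>"
    and "legendre_curve A s \<eta> I \<gamma>"
  shows "((\<exists>l. C_proper_tangent A g s \<xi> I \<gamma> l) \<longleftrightarrow>
      (\<exists>\<epsilon>\<in>{1, -1}. \<exists>b::real.
         circle_curve A g I \<gamma> E \<kappa> \<and>
         (\<forall>i\<in>{1..s}. \<forall>t\<in>I. \<beta> i (\<gamma> t) = b) \<and>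
         (\<forall>t\<in>I. \<kappa> 1 t = - \<epsilon> * sqrt (real s) * b) \<and>
         (\<forall>t\<in>I. E 2 t = (\<epsilon> / sqrt (real s)) *\<^sub>R (\<Sum>i\<in>{1..s}. \<xi> i (\<gamma> t)))))
    \<and> (\<forall>l. C_proper_tangent A g s \<xi> I \<gamma> l \<longrightarrow>
      (\<exists>b::real.
         (\<forall>i\<in>{1..s}. \<forall>t\<in>I. \<beta> i (\<gamma> t) = b) \<and>
         (\<forall>t\<in>I. l t = - real s * b ^ 3) \<and>
         (\<forall>t\<in>I. (\<Sum>i\<in>{1..s}. \<alpha> i (\<gamma> t)) = 0)))"
proof -
  interpret trans_S_manifold A g n s f \<xi> \<eta> \<alpha> \<beta> by (rule assms(1))
  note main = legendre_frenet2_C_proper[OF assms(2,3,5,6) _ assms(4)]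
  show ?thesis
  proof (intro conjI iffI allI impI)
    assume "\<exists>l. C_proper_tangent A g s \<xi> I \<gamma> l"
    then obtain l where "C_proper_tangent A g s \<xi> I \<gamma> l" ..
    from main[OF this] show "\<exists>\<epsilon>\<in>{1, -1}. \<exists>b::real.
         circle_curve A g I \<gamma> E \<kappa> \<and>
         (\<forall>i\<in>{1..s}. \<forall>t\<in>I. \<beta> i (\<gamma> t) = b) \<and>
         (\<forall>t\<in>I. \<kappa> 1 t = - \<epsilon> * sqrt (real s) * b) \<and>
         (\<forall>t\<in>I. E 2 t = (\<epsilon> / sqrt (real s)) *\<^sub>R (\<Sum>i\<in>{1..s}. \<xi> i (\<gamma> t)))"
      by (elim bexE exE conjE) (intro bexI exI conjI)
  next
    assume "\<exists>\<epsilon>\<in>{1, -1}. \<exists>b::real.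
         circle_curve A g I \<gamma> E \<kappa> \<and>
         (\<forall>i\<in>{1..s}. \<forall>t\<in>I. \<beta> i (\<gamma> t) = b) \<and>
         (\<forall>t\<in>I. \<kappa> 1 t = - \<epsilon> * sqrt (real s) * b) \<and>
         (\<forall>t\<in>I. E 2 t = (\<epsilon> / sqrt (real s)) *\<^sub>R (\<Sum>i\<in>{1..s}. \<xi> i (\<gamma> t)))"
    then obtain \<epsilon> :: real where "\<epsilon> \<in> {1, -1}" "circle_curve A g I \<gamma> E \<kappa>"
      "\<And>t. t \<in> I \<Longrightarrow> E 2 t = (\<epsilon> / sqrt (real s)) *\<^sub>R (\<Sum>i\<in>{1..s}. \<xi> i (\<gamma> t))"
      by blast
    then show "\<exists>l. C_proper_tangent A g s \<xi> I \<gamma> l"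
      by (intro circle_C_proper[OF assms(2), of \<gamma> E \<kappa> \<epsilon>]) auto
  next
    fix l assume "C_proper_tangent A g s \<xi> I \<gamma> l"
    from main[OF this] show "\<exists>b::real.
         (\<forall>i\<in>{1..s}. \<forall>t\<in>I. \<beta> i (\<gamma> t) = b) \<and>
         (\<forall>t\<in>I. l t = - real s * b ^ 3) \<and>
         (\<forall>t\<in>I. (\<Sum>i\<in>{1..s}. \<alpha> i (\<gamma> t)) = 0)"
      by blast
  qed
qed

end
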